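(* Let $M\in\mathbb{R}^{p\times v}[s]$ with $p\leqslant v$, let $G=(R,C;E)$ be the edge-weighted bipartite graph associated to $M$ (so $|R|\leqslant|C|$), and assume $G$ has at least one $R$-saturating matching. Let $G_{nr}$ be the graph obtained from $G$ by removing all redundant edges. Then the zero set of $M$ is generically empty if and only if the following property holds: (P) For all subsets $r\subseteq R$ and $c\subseteq C$ with $|r|=|c|$ such that every $R$-saturating matching matches $r$ to $c$, all edges of $G_{nr}$ incident on $r$ have weight zero.
   Context: $\mathbb{R}^{p\times v}[s]$ denotes the $p\times v$ matrices with entries in $\mathbb{R}[s]$. The zero set of $M$ is $\mathrm{zeros}(M)=\{\lambda\in\mathbb{C} : \mathrm{rank}\,M(\lambda)<\mathrm{rank}\,M(s)\}$, where $\mathrm{rank}\,M(s)$ is the rank of $M$ as a polynomial matrix. Associated graph: the edge-weighted bipartite graph $G=(R,C;E)$ associated to $M$ has $R$ = the set of rows, $C$ = the set of columns, an edge between row $i$ and column $j$ exactly when the $(i,j)$ entry of $M$ is a nonzero polynomial, and the weight of that edge is the degree of that polynomial (weight zero means a nonzero constant entry). A matching is a set of edges such that each vertex lies on at most one of them; it is $R$-saturating if it has $|R|$ edges. A matching matches $r\subseteq R$ to $c\subseteq C$ if the set of partners of the vertices of $r$ in the matching is exactly $c$. An edge of $G$ is redundant if it belongs to no $R$-saturating matching of $G$. Genericity: the nonzero entries of $M$ are regarded as chosen independently. That is, let $d_{ij}$ be the weight of the edge $(i,j)\in E$, and consider all matrices whose $(i,j)$ entry is $0$ if $(i,j)\notin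 E$ and is $\sum_{k=0}^{d_{ij}}a_{ij,k}s^k$ if $(i,j)\in E$, with all coefficients $a_{ij,k}$ regarded as independent real parameters ($N$ of them in total). A property holds generically for $M$ if the set of parameter values in $\mathbb{R}^N$ for which it fails is contained in a nontrivial algebraic variety, i.e. in the solution set of $f=0$ for some nonzero polynomial $f$ in the $N$ parameters. *)

theory Defs
  imports
    "HOL-Analysis.Analysis"
    "HOL-Library.Poly_Mapping"
    "HOL-Computational_Algebra.Polynomial_Factorial"
begin

section \<open>The zero set of a polynomial matrix\<close>

definition eval_matrix :: "real poly ^ 'v ^ 'p \<Rightarrow> complex \<Rightarrow> complex ^ 'v ^ 'p" where
  "eval_matrix M z = map_matrix (\<lambda>q. poly (map_poly complex_of_real q) z) M"

text \<open>The rank of \<open>M\<close> as a polynomial matrix is its rank over the field of rational functions.\<close>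

definition poly_rank :: "real poly ^ 'v ^ 'p \<Rightarrow> nat" where
  "poly_rank M = rank (map_matrix to_fract M)"

definition zeros :: "real poly ^ 'v ^ 'p \<Rightarrow> complex set" where
  "zeros M = {z. rank (eval_matrix M z) < poly_rank M}"


section \<open>The associated bipartite graph\<close>

text \<open>
  A bipartite graph on the row set \<open>UNIV :: 'p set\<close> and the column set \<open>UNIV :: 'v set\<close>
  is given by its edges, as pairs (row, column).
\<close>

definition edges :: "real poly ^ 'v ^ 'p \<Rightarrow> ('p \<times> 'v) set" where
  "edges M = {(i, j). M $ i $ j \<noteq> 0}"

definition weight :: "real poly ^ 'v ^ 'p \<Rightarrow> 'p \<times> 'v \<Rightarrow> nat" where
  "weight M = (\<lambda>(i, j). degree (M $ i $ j))"

definition matching :: "('p \<times> 'v) set \<Rightarrow> ('p \<times> 'v) set \<Rightarrow> bool" where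
  "matching E m \<longleftrightarrow> m \<subseteq> E \<and>
     (\<forall>e\<in>m. \<forall>e'\<in>m. fst e = fst e' \<or> snd e = snd e' \<longrightarrow> e = e')"

definition R_saturating :: "('p::finite \<times> 'v::finite) set \<Rightarrow> ('p \<times> 'v) set \<Rightarrow> bool" where
  "R_saturating E m \<longleftrightarrow> matching E m \<and> card m = CARD('p)"

definition matches :: "('p \<times> 'v) set \<Rightarrow> 'p set \<Rightarrow> 'v set \<Rightarrow> bool" where
  "matches m r c \<longleftrightarrow> m `` r = c"

definition redundant :: "('p::finite \<times> 'v::finite) set \<Rightarrow> 'p \<times> 'v \<Rightarrow> bool" where
  "redundant E e \<longleftrightarrow> e \<in> E \<and> (\<nexists>m. R_saturating E m \<and> e \<in> m)"

definition nonredundant_edges :: "('p::finite \<times> 'v::finite) set \<Rightarrow> ('p \<times> 'v) set" where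
  "nonredundant_edges E = E - {e. redundant E e}"

definition property_P :: "('p::finite \<times> 'v::finite) set \<Rightarrow> ('p \<times> 'v \<Rightarrow> nat) \<Rightarrow> bool" where
  "property_P E w \<longleftrightarrow>
     (\<forall>r c. card r = card c \<and> (\<forall>m. R_saturating E m \<longrightarrow> matches m r c) \<longrightarrow>
        (\<forall>e\<in>nonredundant_edges E. fst e \<in> r \<longrightarrow> w e = 0))"


section \<open>Genericity\<close>

text \<open>
  Real polynomials in variables of type \<open>'x\<close>: a polynomial maps each monomial to its
  coefficient, and a monomial maps each variable to its exponent.
\<close>

type_synonym 'x mpoly = "('x \<Rightarrow>\<^sub>0 nat) \<Rightarrow>\<^sub>0 real"

definition mpoly_vars :: "'x mpoly \<Rightarrow> 'x set" where
  "mpoly_vars f = (\<Union>m \<in> Poly_Mapping.keys f. Poly_Mapping.keys m)"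

definition mpoly_eval :: "'x mpoly \<Rightarrow> ('x \<Rightarrow> real) \<Rightarrow> real" where
  "mpoly_eval f a =
     (\<Sum>m \<in> Poly_Mapping.keys f. Poly_Mapping.lookup f m *
        (\<Prod>x \<in> Poly_Mapping.keys m. a x ^ Poly_Mapping.lookup m x))"

text \<open>
  The index \<open>(i, j, k)\<close> stands for the coefficient of \<open>s ^ k\<close> in the entry \<open>(i, j)\<close>.
  The parameter space is \<open>params M \<rightarrow>\<^sub>E UNIV\<close>. Leading coefficients may vanish in it, so that
  the matrices of the family need not all have \<open>edges M\<close> and \<open>weight M\<close> as their graph.
\<close>

definition params :: "real poly ^ 'v ^ 'p \<Rightarrow> ('p \<times> 'v \<times> nat) set" where
  "params M = {(i, j, k). (i, j) \<in> edges M \<and> k \<le> weight M (i, j)}"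

definition family_matrix ::
    "real poly ^ 'v ^ 'p \<Rightarrow> ('p \<times> 'v \<times> nat \<Rightarrow> real) \<Rightarrow> real poly ^ 'v ^ 'p" where
  "family_matrix M a =
     (\<chi> i j. if (i, j) \<in> edges M then \<Sum>k\<le>weight M (i, j). monom (a (i, j, k)) k else 0)"

definition generically ::
    "real poly ^ 'v ^ 'p \<Rightarrow> (real poly ^ 'v ^ 'p \<Rightarrow> bool) \<Rightarrow> bool" where
  "generically M Q \<longleftrightarrow>
     (\<exists>f :: ('p \<times> 'v \<times> nat) mpoly. f \<noteq> 0 \<and> mpoly_vars f \<subseteq> params M \<and>
        {a \<in> params M \<rightarrow>\<^sub>E UNIV. \<not> Q (family_matrix M a)} \<subseteq> {a. mpoly_eval f a = 0})"

end

(*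
Write M_nr for the nonredundant part of M.  In the Leibniz expansion of a maximal minor only
R-saturating matchings contribute, so M(z) and M_nr(z) have the same maximal minors.

If (P) holds, let x be a left kernel vector of M_nr(z) with support r.  Each column of M_nr
adjacent to r gives an equation that can be solved for one constant coefficient.  Thus the
parameters admitting such x and z are the image of a polynomial map in fewer variables than
there are parameters: by Hall's inequality |N(r)| >= |r|, and in case of equality (P) says that
z does not occur.  Counting monomials, the components of such a map are algebraically
dependent, and a dependence relation is a nonzero polynomial vanishing on the bad parameters.
The product of these polynomials over all r witnesses genericity.

If (P) fails for r, c and an edge e, then the rows r of M_nr live in the columns c, and the
determinant of that square block is generically a nonconstant polynomial in s (use a matching
through e), hence has a complex root, which is a zero of M.
*)

theory Submission
  imports Defs "HOL-Computational_Algebra.Fundamental_Theorem_Algebra"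
begin

section \<open>Rank and maximal minors\<close>

text \<open>\<open>\<sigma>\<close> need not be injective: a repeated column only adds a zero minor.
  Up to sign, the nonzero determinants obtained are the nonzero maximal minors.\<close>

definition select_cols :: "('p \<Rightarrow> 'v) \<Rightarrow> 'a ^ 'v ^ 'p \<Rightarrow> 'a ^ 'p ^ 'p" where
  "select_cols \<sigma> A = (\<chi> i k. A $ i $ \<sigma> k)"

text \<open>Leibniz formula for a ring homomorphism \<open>h\<close>: evaluation at a real or
  complex point, or the embedding into the field of fractions.\<close>

lemma det_map_matrix:
  fixes h :: "'a::comm_ring_1 \<Rightarrow> 'b::comm_ring_1"
  assumes "h 0 = 0" "h 1 = 1" "\<And>x y. h (x + y) = h x + h y" "\<And>x y. h (x * y) = h x * h y"
  shows "det (map_matrix h A) = h (det A)"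
proof -
  have sum: "h (sum f S) = (\<Sum>x\<in>S. h (f x))" for f :: "_ \<Rightarrow> 'a" and S
    using assms by (induction S rule: infinite_finite_induct) auto
  have prod: "h (prod f S) = (\<Prod>x\<in>S. h (f x))" for f :: "_ \<Rightarrow> 'a" and S
    using assms by (induction S rule: infinite_finite_induct) auto
  have "h (- 1) + h 1 = 0"
    using assms(1) assms(3)[of "- 1" 1] by simp
  then have neg: "h (- 1) = - 1"
    using assms(2) by (simp add: eq_neg_iff_add_eq_0)
  have sgn: "h (of_int (sign p)) = of_int (sign p)" for p :: "'z \<Rightarrow> 'z"
    using assms(2) neg by (simp add: sign_def)
  show ?thesis
    unfolding det_def sum assms(4) prod sgn by simp
qed

text \<open>Rank is the dimension of the span of the set \<open>rows A\<close>, which forgets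
  repetitions. Full rank therefore means distinct rows forming an independent set, and both together
  amount to a trivial left kernel.\<close>

lemma rank_full_iff_independent_rows:
  fixes A :: "'a::field ^ 'v ^ 'p"
  shows "rank A = CARD('p) \<longleftrightarrow> (\<forall>x. (\<forall>j. (\<Sum>i\<in>UNIV. x i * A $ i $ j) = 0) \<longrightarrow> (\<forall>i. x i = 0))"
proof -
  have rows: "rows A = range (\<lambda>i. row i A)"
    by (auto simp: rows_def)
  have comp: "(\<Sum>i\<in>UNIV. x i *s row i A) = 0 \<longleftrightarrow> (\<forall>j. (\<Sum>i\<in>UNIV. x i * A $ i $ j) = 0)" for x
    by (simp add: vec_eq_iff row_def)
  have "rank A = CARD('p) \<longleftrightarrow> inj (\<lambda>i. row i A) \<and> vec.independent (rows A)"
  proof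
    assume r: "rank A = CARD('p)"
    have "vec.dim (rows A) \<le> card (rows A)"
      by (rule vec.dim_le_card) (auto simp: rows intro: vec.span_base)
    moreover have "card (rows A) \<le> CARD('p)"
      unfolding rows by (rule card_image_le) simp
    ultimately have c: "card (rows A) = CARD('p)" "card (rows A) = vec.dim (rows A)"
      using r by (auto simp: row_rank_def_gen)
    have "inj (\<lambda>i. row i A)"
      using c(1) unfolding rows by (intro eq_card_imp_inj_on) auto
    moreover have "vec.independent (rows A)"
      using vec.card_eq_dim[of "rows A" "rows A"] c(2) by (auto simp: rows intro: vec.span_base)
    ultimately show "inj (\<lambda>i. row i A) \<and> vec.independent (rows A)" ..
  next
    assume "inj (\<lambda>i. row i A) \<and> vec.independent (rows A)"
    then show "rank A = CARD('p)"
      by (simp add: row_rank_def_gen vec.dim_eq_card_independent card_image rows)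
  qed
  also have "\<dots> \<longleftrightarrow> (\<forall>x. (\<Sum>i\<in>UNIV. x i *s row i A) = 0 \<longrightarrow> (\<forall>i. x i = 0))"
  proof
    assume as: "inj (\<lambda>i. row i A) \<and> vec.independent (rows A)"
    show "\<forall>x. (\<Sum>i\<in>UNIV. x i *s row i A) = 0 \<longrightarrow> (\<forall>i. x i = 0)"
    proof (intro allI impI)
      fix x i
      assume x: "(\<Sum>i\<in>UNIV. x i *s row i A) = 0"
      define u where "u = x \<circ> inv (\<lambda>i. row i A)"
      have u: "u (row i A) = x i" for i
        using as inv_f_f[of "\<lambda>i. row i A" i] by (simp add: u_def)
      have "(\<Sum>v\<in>rows A. u v *s v) = (\<Sum>i\<in>UNIV. x i *s row i A)"
        using as by (simp add: rows sum.reindex u)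
      then have "\<forall>v\<in>rows A. u v = 0"
        using as x vec.dependent_finite[of "rows A"] by (auto simp: rows)
      then show "x i = 0"
        by (auto simp: rows u)
    qed
  next
    assume as: "\<forall>x. (\<Sum>i\<in>UNIV. x i *s row i A) = 0 \<longrightarrow> (\<forall>i. x i = 0)"
    have inj: "inj (\<lambda>i. row i A)"
    proof (rule injI, rule ccontr)
      fix i k assume eq: "row i A = row k A" and "i \<noteq> k"
      define x where "x l = (if l = i then 1 else if l = k then - 1 else 0 :: 'a)" for l
      have "(\<Sum>l\<in>UNIV. x l *s row l A) = (\<Sum>l\<in>{i, k}. x l *s row l A)"
        by (rule sum.mono_neutral_right) (auto simp: x_def)
      also have "\<dots> = 0"
        using \<open>i \<noteq> k\<close> eq by (simp add: x_def)
      finally have "x i = 0"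
        using as by blast
      then show False
        by (simp add: x_def)
    qed
    moreover have "vec.independent (rows A)"
    proof
      assume "vec.dependent (rows A)"
      then obtain u v where u: "v \<in> rows A" "u v \<noteq> 0" "(\<Sum>v\<in>rows A. u v *s v) = 0"
        using vec.dependent_finite[of "rows A"] by (auto simp: rows)
      have "(\<Sum>i\<in>UNIV. u (row i A) *s row i A) = 0"
        using u(3) inj by (simp add: rows sum.reindex)
      then show False
        using as u(1,2) by (fastforce simp: rows)
    qed
    ultimately show "inj (\<lambda>i. row i A) \<and> vec.independent (rows A)" ..
  qed
  finally show ?thesis
    by (simp add: comp)
qed

text \<open>A trivial left kernel gives a right inverse, so the columns span; a basis chosen among
  them has \<open>CARD('p)\<close> members and provides \<open>\<sigma>\<close>. Conversely, a left
  kernel vector of \<open>A\<close> annihilates every selection of columns.\<close>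

lemma rank_full_iff_nonzero_minor:
  fixes A :: "'a::field ^ 'v ^ 'p"
  shows "rank A = CARD('p) \<longleftrightarrow> (\<exists>\<sigma>. det (select_cols \<sigma> A) \<noteq> 0)"
proof
  assume "rank A = CARD('p)"
  then have "\<forall>x. (\<Sum>i\<in>UNIV. x i *s row i A) = 0 \<longrightarrow> (\<forall>i. x i = 0)"
    by (simp add: rank_full_iff_independent_rows vec_eq_iff row_def)
  then have "\<exists>B :: 'a ^ 'p ^ 'v. A ** B = mat 1"
    by (rule iffD2[OF matrix_right_invertible_independent_rows])
  then have span: "vec.span (columns A) = UNIV"
    by (rule iffD1[OF matrix_right_invertible_span_columns])
  obtain B where B: "B \<subseteq> columns A" "columns A \<subseteq> vec.span B" "card B = vec.dim (columns A)"
    by (metis vec.basis_exists)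
  have "finite B"
    by (rule finite_subset[OF B(1)]) (simp add: columns_def full_SetCompr_eq)
  moreover have "card B = CARD('p)"
    using B(3) span by (metis vec.dim_span vec_dim_card)
  ultimately obtain h where h: "bij_betw h (UNIV :: 'p set) B"
    by (metis finite_same_card_bij finite)
  have "\<exists>j. column j A = h k" for k
  proof -
    have "h k \<in> columns A"
      using bij_betw_apply[OF h, of k] B(1) by auto
    then show ?thesis
      unfolding columns_def mem_Collect_eq by metis
  qed
  then obtain \<sigma> where \<sigma>: "\<And>k. column (\<sigma> k) A = h k"
    by metis
  have "column k (select_cols \<sigma> A) = h k" for k
    using \<sigma>[of k] by (simp add: select_cols_def column_def)
  then have "columns (select_cols \<sigma> A) = B"
    using h by (simp add: columns_def full_SetCompr_eq bij_betw_def)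
  moreover have "vec.span B = UNIV"
    using B(2) span by (metis vec.span_mono vec.span_span top.extremum_unique)
  ultimately have "\<exists>C. select_cols \<sigma> A ** C = mat 1"
    by (intro iffD2[OF matrix_right_invertible_span_columns]) simp
  then show "\<exists>\<sigma>. det (select_cols \<sigma> A) \<noteq> 0"
    by (metis invertible_det_nz invertible_right_inverse)
next
  assume "\<exists>\<sigma>. det (select_cols \<sigma> A) \<noteq> 0"
  then obtain \<sigma> where "det (select_cols \<sigma> A) \<noteq> 0" ..
  then have "\<exists>B. select_cols \<sigma> A ** B = mat 1"
    by (meson invertible_def invertible_det_nz)
  then have "\<forall>x. (\<Sum>i\<in>UNIV. x i *s row i (select_cols \<sigma> A)) = 0 \<longrightarrow> (\<forall>i. x i = 0)"
    by (rule iffD1[OF matrix_right_invertible_independent_rows])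
  then have "\<forall>x. (\<forall>k. (\<Sum>i\<in>UNIV. x i * A $ i $ \<sigma> k) = 0) \<longrightarrow> (\<forall>i. x i = 0)"
    by (simp add: select_cols_def vec_eq_iff row_def)
  then show "rank A = CARD('p)"
    unfolding rank_full_iff_independent_rows by blast
qed

section \<open>Polynomial functions\<close>

text \<open>Polynomials are handled as functions, so that witnesses arise from closure rules; a
  formal polynomial is extracted for the final genericity statement.\<close>

definition poly_fun :: "'x set \<Rightarrow> (('x \<Rightarrow> real) \<Rightarrow> real) \<Rightarrow> bool" where
  "poly_fun V g \<longleftrightarrow> (\<exists>f. mpoly_vars f \<subseteq> V \<and> (\<forall>a. mpoly_eval f a = g a))"

lemma mpoly_eval_superset:
  assumes "finite S" "Poly_Mapping.keys f \<subseteq> S"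
  shows "mpoly_eval f a = (\<Sum>m\<in>S. Poly_Mapping.lookup f m *
    (\<Prod>x\<in>Poly_Mapping.keys m. a x ^ Poly_Mapping.lookup m x))"
  unfolding mpoly_eval_def
  using assms by (intro sum.mono_neutral_left) (auto simp: in_keys_iff)

lemma mpoly_eval_add: "mpoly_eval (f + g) a = mpoly_eval f a + mpoly_eval g a"
proof -
  let ?S = "Poly_Mapping.keys f \<union> Poly_Mapping.keys g"
  have "mpoly_eval h a = (\<Sum>m\<in>?S. Poly_Mapping.lookup h m *
      (\<Prod>x\<in>Poly_Mapping.keys m. a x ^ Poly_Mapping.lookup m x))" if "h \<in> {f, g, f + g}" for h
    using that keys_add[of f g] by (intro mpoly_eval_superset) auto
  then show ?thesis
    by (simp add: lookup_add sum.distrib distrib_right)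
qed

lemma mpoly_eval_sum: "mpoly_eval (\<Sum>i\<in>I. f i) a = (\<Sum>i\<in>I. mpoly_eval (f i) a)"
proof (induction I rule: infinite_finite_induct)
  case (insert i I)
  then show ?case
    by (simp add: mpoly_eval_add)
qed (simp_all add: mpoly_eval_def)

lemma mpoly_eval_single:
  "mpoly_eval (Poly_Mapping.single m c) a =
    c * (\<Prod>x\<in>Poly_Mapping.keys m. a x ^ Poly_Mapping.lookup m x)"
  by (simp add: mpoly_eval_def)

lemma monomial_value_superset:
  fixes a :: "'x \<Rightarrow> real"
  assumes "finite S" "Poly_Mapping.keys m \<subseteq> S"
  shows "(\<Prod>x\<in>Poly_Mapping.keys m. a x ^ Poly_Mapping.lookup m x) = (\<Prod>x\<in>S. a x ^ Poly_Mapping.lookup m x)"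
  using assms by (intro prod.mono_neutral_left) (auto simp: in_keys_iff)

lemma monomial_value_add:
  fixes a :: "'x \<Rightarrow> real"
  shows "(\<Prod>x\<in>Poly_Mapping.keys (m + n). a x ^ Poly_Mapping.lookup (m + n) x) =
    (\<Prod>x\<in>Poly_Mapping.keys m. a x ^ Poly_Mapping.lookup m x) *
    (\<Prod>x\<in>Poly_Mapping.keys n. a x ^ Poly_Mapping.lookup n x)"
proof -
  let ?S = "Poly_Mapping.keys m \<union> Poly_Mapping.keys n"
  have "(\<Prod>x\<in>Poly_Mapping.keys k. a x ^ Poly_Mapping.lookup k x) = (\<Prod>x\<in>?S. a x ^ Poly_Mapping.lookup k x)"
    if "k \<in> {m, n, m + n}" for k
    using that keys_add[of m n] by (intro monomial_value_superset) auto
  then have "(\<Prod>x\<in>Poly_Mapping.keys (m + n). a x ^ Poly_Mapping.lookup (m + n) x) =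
      (\<Prod>x\<in>?S. a x ^ Poly_Mapping.lookup (m + n) x)"
    "(\<Prod>x\<in>Poly_Mapping.keys m. a x ^ Poly_Mapping.lookup m x) = (\<Prod>x\<in>?S. a x ^ Poly_Mapping.lookup m x)"
    "(\<Prod>x\<in>Poly_Mapping.keys n. a x ^ Poly_Mapping.lookup n x) = (\<Prod>x\<in>?S. a x ^ Poly_Mapping.lookup n x)"
    by blast+
  then show ?thesis
    by (simp only: lookup_add power_add prod.distrib)
qed

lemma poly_mapping_sum_single:
  fixes f :: "'a \<Rightarrow>\<^sub>0 'b::comm_monoid_add"
  shows "f = (\<Sum>m\<in>Poly_Mapping.keys f. Poly_Mapping.single m (Poly_Mapping.lookup f m))"
proof (rule poly_mapping_eqI)
  fix k
  have "(\<Sum>m\<in>Poly_Mapping.keys f. Poly_Mapping.lookup f m when m = k) = Poly_Mapping.lookup f k"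
    by (simp add: when_def in_keys_iff sum.delta)
  then show "Poly_Mapping.lookup f k = Poly_Mapping.lookup
      (\<Sum>m\<in>Poly_Mapping.keys f. Poly_Mapping.single m (Poly_Mapping.lookup f m)) k"
    by (simp add: lookup_sum lookup_single)
qed

lemma mpoly_eval_mult: "mpoly_eval (f * g) a = mpoly_eval f a * mpoly_eval g a"
proof -
  let ?s = "\<lambda>f m. Poly_Mapping.single m (Poly_Mapping.lookup f m) :: 'a mpoly"
  have "f * g = (\<Sum>m\<in>Poly_Mapping.keys f. \<Sum>n\<in>Poly_Mapping.keys g. ?s f m * ?s g n)"
    by (subst poly_mapping_sum_single[of f], subst poly_mapping_sum_single[of g])
      (rule sum_product)
  then show ?thesis
    by (simp add: mpoly_eval_sum mult_single mpoly_eval_single monomial_value_add)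
      (simp add: mpoly_eval_def sum_product mult_ac)
qed

lemma poly_fun_const: "poly_fun V (\<lambda>a. c)"
  unfolding poly_fun_def
  by (rule exI[of _ "Poly_Mapping.single 0 c"]) (auto simp: mpoly_eval_single mpoly_vars_def)

lemma poly_fun_var: "x \<in> V \<Longrightarrow> poly_fun V (\<lambda>a. a x)"
  unfolding poly_fun_def
  by (rule exI[of _ "Poly_Mapping.single (Poly_Mapping.single x 1) 1"])
    (auto simp: mpoly_eval_single mpoly_vars_def)

lemma poly_fun_add:
  assumes "poly_fun V g" "poly_fun V h"
  shows "poly_fun V (\<lambda>a. g a + h a)"
proof -
  obtain p q where pq: "mpoly_vars p \<subseteq> V" "mpoly_vars q \<subseteq> V"
    "\<And>a. mpoly_eval p a = g a" "\<And>a. mpoly_eval q a = h a"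
    using assms unfolding poly_fun_def by blast
  moreover have "mpoly_vars (p + q) \<subseteq> mpoly_vars p \<union> mpoly_vars q"
    using keys_add[of p q] unfolding mpoly_vars_def by blast
  ultimately show ?thesis
    unfolding poly_fun_def by (intro exI[of _ "p + q"]) (auto simp: mpoly_eval_add)
qed

lemma poly_fun_mult:
  assumes "poly_fun V g" "poly_fun V h"
  shows "poly_fun V (\<lambda>a. g a * h a)"
proof -
  obtain p q where pq: "mpoly_vars p \<subseteq> V" "mpoly_vars q \<subseteq> V"
    "\<And>a. mpoly_eval p a = g a" "\<And>a. mpoly_eval q a = h a"
    using assms unfolding poly_fun_def by blast
  moreover have "mpoly_vars (p * q) \<subseteq> mpoly_vars p \<union> mpoly_vars q"
  proof
    fix x assume "x \<in> mpoly_vars (p * q)"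
    then obtain m n where "m \<in> Poly_Mapping.keys p" "n \<in> Poly_Mapping.keys q"
      "x \<in> Poly_Mapping.keys (m + n)"
      using keys_mult[of p q] unfolding mpoly_vars_def by blast
    then show "x \<in> mpoly_vars p \<union> mpoly_vars q"
      using keys_add[of m n] unfolding mpoly_vars_def by blast
  qed
  ultimately show ?thesis
    unfolding poly_fun_def by (intro exI[of _ "p * q"]) (auto simp: mpoly_eval_mult)
qed

lemma poly_fun_sum: "(\<And>i. i \<in> I \<Longrightarrow> poly_fun V (g i)) \<Longrightarrow> poly_fun V (\<lambda>a. \<Sum>i\<in>I. g i a)"
  by (induction I rule: infinite_finite_induct) (auto intro: poly_fun_const poly_fun_add)

lemma poly_fun_prod: "(\<And>i. i \<in> I \<Longrightarrow> poly_fun V (g i)) \<Longrightarrow> poly_fun V (\<lambda>a. \<Prod>i\<in>I. g i a)"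
  by (induction I rule: infinite_finite_induct) (auto intro: poly_fun_const poly_fun_mult)

lemma poly_fun_power: "poly_fun V g \<Longrightarrow> poly_fun V (\<lambda>a. g a ^ n)"
  by (induction n) (auto intro: poly_fun_const poly_fun_mult)

text \<open>Lets a parameter point be replaced by its restriction, as the extensional parameter
  space demands.\<close>

lemma poly_fun_cong:
  assumes "poly_fun V g" "\<And>x. x \<in> V \<Longrightarrow> a x = b x"
  shows "g a = g b"
proof -
  obtain f where "mpoly_vars f \<subseteq> V" and f: "\<And>a. g a = mpoly_eval f a"
    using assms(1) unfolding poly_fun_def by metis
  then have "a x = b x" if "m \<in> Poly_Mapping.keys f" "x \<in> Poly_Mapping.keys m" for m x
    using that assms(2) by (auto simp: mpoly_vars_def)
  then show ?thesis
    unfolding f mpoly_eval_def by (intro sum.cong) (auto intro!: prod.cong)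
qed

text \<open>Induction on the variables. Exponent vectors are functions, and those in
  \<open>S\<close> already differ on \<open>X\<close>, so that no terms can cancel.\<close>

lemma nonzero_polynomial_has_nonroot:
  fixes c :: "('x \<Rightarrow> nat) \<Rightarrow> real"
  assumes "finite X" "finite S" "inj_on (\<lambda>m. restrict m X) S" "m0 \<in> S" "c m0 \<noteq> 0"
  shows "\<exists>a. (\<Sum>m\<in>S. c m * (\<Prod>x\<in>X. a x ^ m x)) \<noteq> 0"
  using assms
proof (induction X arbitrary: S m0 rule: finite_induct)
  case empty
  then have "m = m0" if "m \<in> S" for m
    using that by (auto simp: inj_on_def restrict_def)
  then have "S = {m0}"
    using empty.prems(3) by blast
  then show ?case
    using empty.prems by simp
next
  case (insert z X)
  \<comment> \<open>The terms with \<open>z\<close>-exponent \<open>m0 z\<close>. They agree at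
    \<open>z\<close>, hence still differ on \<open>X\<close>, and the induction hypothesis makes
    this coefficient nonzero at some \<open>a\<close>.\<close>
  let ?T = "{m \<in> S. m z = m0 z}"
  have inj: "inj_on (\<lambda>m. restrict m X) ?T"
  proof (rule inj_onI)
    fix m n assume mn: "m \<in> ?T" "n \<in> ?T" "restrict m X = restrict n X"
    then have "restrict m (insert z X) = restrict n (insert z X)"
      by (auto simp: restrict_def fun_eq_iff) metis
    then show "m = n"
      using inj_onD[OF insert.prems(2), of m n] mn(1,2) by simp
  qed
  have "\<exists>a. (\<Sum>m\<in>?T. c m * (\<Prod>x\<in>X. a x ^ m x)) \<noteq> 0"
    by (rule insert.IH[OF _ inj, of m0]) (use insert.prems in simp_all)
  then obtain a where a: "(\<Sum>m\<in>?T. c m * (\<Prod>x\<in>X. a x ^ m x)) \<noteq> 0" ..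
  \<comment> \<open>Fixing all variables but \<open>z\<close> leaves a nonzero real polynomial in
    \<open>z\<close>, which has a nonroot \<open>t\<close>.\<close>
  define p where "p = (\<Sum>m\<in>S. monom (c m * (\<Prod>x\<in>X. a x ^ m x)) (m z))"
  have "coeff p (m0 z) = (\<Sum>m\<in>?T. c m * (\<Prod>x\<in>X. a x ^ m x))"
    using insert.prems(1) by (simp add: p_def coeff_sum sum.If_cases Int_def)
  then have "p \<noteq> 0"
    using a by auto
  then obtain t where t: "poly p t \<noteq> 0"
    using poly_all_0_iff_0 by blast
  have "(\<Sum>m\<in>S. c m * (\<Prod>x\<in>insert z X. (a(z := t)) x ^ m x)) = poly p t"
    unfolding p_def poly_sum
  proof (intro sum.cong refl)
    fix m
    have "(\<Prod>x\<in>X. (a(z := t)) x ^ m x) = (\<Prod>x\<in>X. a x ^ m x)"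
      using insert.hyps by (intro prod.cong) auto
    then show "c m * (\<Prod>x\<in>insert z X. (a(z := t)) x ^ m x) =
        poly (monom (c m * (\<Prod>x\<in>X. a x ^ m x)) (m z)) t"
      using insert.hyps by (simp add: poly_monom)
  qed
  then show ?case
    using t by metis
qed

lemma finite_mpoly_vars: "finite (mpoly_vars f)"
  by (simp add: mpoly_vars_def)

lemma mpoly_nonzero_has_nonroot:
  fixes f :: "'x mpoly"
  assumes "f \<noteq> 0"
  shows "\<exists>a. mpoly_eval f a \<noteq> 0"
proof -
  obtain k where k: "k \<in> Poly_Mapping.keys f"
    using assms by (metis ex_in_conv keys_eq_empty)
  let ?X = "mpoly_vars f" and ?L = "Poly_Mapping.lookup :: ('x \<Rightarrow>\<^sub>0 nat) \<Rightarrow> _"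
  have inj: "inj_on (\<lambda>m. restrict (?L m) ?X) (Poly_Mapping.keys f)"
  proof (rule inj_onI)
    fix m n
    assume mn: "m \<in> Poly_Mapping.keys f" "n \<in> Poly_Mapping.keys f"
      "restrict (?L m) ?X = restrict (?L n) ?X"
    have "?L m x = ?L n x" for x
    proof (cases "x \<in> ?X")
      case True
      then show ?thesis
        using fun_cong[OF mn(3), of x] by simp
    next
      case False
      then show ?thesis
        using mn(1,2) by (auto simp: mpoly_vars_def in_keys_iff)
    qed
    then show "m = n"
      by (intro poly_mapping_eqI)
  qed
  have inj': "inj_on ?L (Poly_Mapping.keys f)"
    by (auto intro!: inj_onI poly_mapping_eqI)
  define c where "c = (\<lambda>m. Poly_Mapping.lookup f (inv_into (Poly_Mapping.keys f) ?L m))"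
  have c: "c (?L m) = Poly_Mapping.lookup f m" if "m \<in> Poly_Mapping.keys f" for m
    using that inj' by (simp add: c_def)
  have "\<exists>a. (\<Sum>m\<in>?L ` Poly_Mapping.keys f. c m * (\<Prod>x\<in>?X. a x ^ m x)) \<noteq> 0"
  proof (rule nonzero_polynomial_has_nonroot)
    show "inj_on (\<lambda>m. restrict m ?X) (?L ` Poly_Mapping.keys f)"
      using inj by (auto simp: inj_on_def)
    show "?L k \<in> ?L ` Poly_Mapping.keys f" "c (?L k) \<noteq> 0"
      using k c by (auto simp: in_keys_iff)
  qed (auto simp: finite_mpoly_vars)
  then obtain a where a: "(\<Sum>m\<in>?L ` Poly_Mapping.keys f. c m * (\<Prod>x\<in>?X. a x ^ m x)) \<noteq> 0" ..
  have "mpoly_eval f a = (\<Sum>m\<in>?L ` Poly_Mapping.keys f. c m * (\<Prod>x\<in>?X. a x ^ m x))"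
    unfolding mpoly_eval_def sum.reindex[OF inj']
  proof (intro sum.cong refl)
    fix m assume m: "m \<in> Poly_Mapping.keys f"
    then have "(\<Prod>x\<in>Poly_Mapping.keys m. a x ^ ?L m x) = (\<Prod>x\<in>?X. a x ^ ?L m x)"
      by (intro monomial_value_superset finite_mpoly_vars) (auto simp: mpoly_vars_def)
    then show "Poly_Mapping.lookup f m * (\<Prod>x\<in>Poly_Mapping.keys m. a x ^ ?L m x) =
        ((\<lambda>m. c m * (\<Prod>x\<in>?X. a x ^ m x)) \<circ> ?L) m"
      using c[OF m] by simp
  qed
  then have "mpoly_eval f a \<noteq> 0"
    using a by simp
  then show ?thesis
    by blast
qed

section \<open>Polynomials in one variable and restriction to lines\<close>

definition univariate_poly :: "(real \<Rightarrow> real) \<Rightarrow> bool" where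
  "univariate_poly h \<longleftrightarrow> (\<exists>p. \<forall>t. h t = poly p t)"

lemma univariate_poly_const: "univariate_poly (\<lambda>t. c)"
  unfolding univariate_poly_def by (rule exI[of _ "[:c:]"]) simp

lemma univariate_poly_id: "univariate_poly (\<lambda>t. t)"
  unfolding univariate_poly_def by (rule exI[of _ "[:0, 1:]"]) simp

lemma univariate_poly_add: "univariate_poly g \<Longrightarrow> univariate_poly h \<Longrightarrow> univariate_poly (\<lambda>t. g t + h t)"
  unfolding univariate_poly_def by (metis poly_add)

lemma univariate_poly_diff: "univariate_poly g \<Longrightarrow> univariate_poly h \<Longrightarrow> univariate_poly (\<lambda>t. g t - h t)"
  unfolding univariate_poly_def by (metis poly_diff)

lemma univariate_poly_mult: "univariate_poly g \<Longrightarrow> univariate_poly h \<Longrightarrow> univariate_poly (\<lambda>t. g t * h t)"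
  unfolding univariate_poly_def by (metis poly_mult)

lemma univariate_poly_power: "univariate_poly g \<Longrightarrow> univariate_poly (\<lambda>t. g t ^ n)"
  unfolding univariate_poly_def by (metis poly_power)

lemma univariate_poly_sum: "(\<And>i. i \<in> I \<Longrightarrow> univariate_poly (g i)) \<Longrightarrow> univariate_poly (\<lambda>t. \<Sum>i\<in>I. g i t)"
  by (induction I rule: infinite_finite_induct) (auto intro: univariate_poly_const univariate_poly_add)

lemma univariate_poly_prod: "(\<And>i. i \<in> I \<Longrightarrow> univariate_poly (g i)) \<Longrightarrow> univariate_poly (\<lambda>t. \<Prod>i\<in>I. g i t)"
  by (induction I rule: infinite_finite_induct) (auto intro: univariate_poly_const univariate_poly_mult)

lemmas univariate_poly_intros =
  univariate_poly_const univariate_poly_id univariate_poly_add univariate_poly_diff univariate_poly_mult univariate_poly_power univariate_poly_sum univariate_poly_prod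

lemma univariate_poly_det: "(\<And>i j. univariate_poly (\<lambda>t. A t $ i $ j)) \<Longrightarrow> univariate_poly (\<lambda>t. det (A t))"
  unfolding det_def by (intro univariate_poly_intros)

text \<open>A product of nonzero real polynomials is nonzero, so nonroots at possibly different
  points yield a common one.\<close>

lemma univariate_poly_mult_nonzero:
  assumes "univariate_poly g" "univariate_poly h" "g s \<noteq> 0" "h t \<noteq> 0"
  shows "\<exists>u. g u * h u \<noteq> 0"
proof -
  obtain p q where "\<And>t. g t = poly p t" "\<And>t. h t = poly q t"
    using assms(1,2) unfolding univariate_poly_def by blast
  moreover from this have "p * q \<noteq> 0"
    using assms(3,4) by auto
  ultimately show ?thesis
    using poly_all_0_iff_0[of "p * q"] by auto
qed

definition line :: "('x \<Rightarrow> real) \<Rightarrow> ('x \<Rightarrow> real) \<Rightarrow> real \<Rightarrow> 'x \<Rightarrow> real" where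
  "line a b t = (\<lambda>x. a x + t * (b x - a x))"

lemma line_0 [simp]: "line a b 0 = a" and line_1 [simp]: "line a b 1 = b"
  by (auto simp: line_def)

lemma univariate_poly_line: "univariate_poly (\<lambda>t. line a b t x)"
  unfolding line_def by (intro univariate_poly_intros)

lemma univariate_poly_poly_fun_line:
  assumes "poly_fun V g"
  shows "univariate_poly (\<lambda>t. g (line a b t))"
proof -
  obtain f where g: "\<And>a. g a = mpoly_eval f a"
    using assms unfolding poly_fun_def by metis
  show ?thesis
    unfolding g mpoly_eval_def by (intro univariate_poly_intros univariate_poly_line)
qed

text \<open>A line joins a nonroot of one factor to a nonroot of the product of the others; both
  restrict to nonzero polynomials in one variable there.\<close>

lemma prod_poly_fun_nonzero:
  assumes "finite I" "\<And>i. i \<in> I \<Longrightarrow> poly_fun V (g i)" "\<And>i. i \<in> I \<Longrightarrow> \<exists>a. g i a \<noteq> 0"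
  shows "\<exists>a. (\<Prod>i\<in>I. g i a) \<noteq> 0"
  using assms
proof (induction I rule: finite_induct)
  case (insert i I)
  obtain a where "g i a \<noteq> 0"
    using insert.prems(2) by blast
  moreover obtain b where "(\<Prod>i\<in>I. g i b) \<noteq> 0"
    using insert.IH insert.prems by blast
  moreover have "univariate_poly (\<lambda>t. g i (line a b t))" "univariate_poly (\<lambda>t. \<Prod>i\<in>I. g i (line a b t))"
    using insert.prems by (auto intro!: univariate_poly_poly_fun_line univariate_poly_prod)
  ultimately obtain u where "g i (line a b u) * (\<Prod>i\<in>I. g i (line a b u)) \<noteq> 0"
    using univariate_poly_mult_nonzero[of "\<lambda>t. g i (line a b t)" "\<lambda>t. \<Prod>i\<in>I. g i (line a b t)" 0 1] by auto
  then show ?case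
    using insert.hyps by auto
qed auto

section \<open>Algebraic dependence by counting monomials\<close>

text \<open>Gaussian elimination, by induction on the equations: an equation \<open>e\<close> that
  involves the unknown \<open>n\<close> serves to remove \<open>n\<close> from the others.\<close>

lemma homogeneous_system_nontrivial_solution:
  fixes A :: "'e \<Rightarrow> 'm \<Rightarrow> 'a::field"
  assumes "finite T" "finite S" "card T < card S"
  shows "\<exists>c. (\<exists>m\<in>S. c m \<noteq> 0) \<and> (\<forall>e\<in>T. (\<Sum>m\<in>S. A e m * c m) = 0)"
  using assms
proof (induction T arbitrary: S A rule: finite_induct)
  case empty
  then obtain m where "m \<in> S"
    by (metis all_not_in_conv card.empty less_irrefl)
  then show ?case
    by (intro exI[of _ "\<lambda>_. 1"]) auto
next
  case (insert e T)
  show ?case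
  proof (cases "\<forall>m\<in>S. A e m = 0")
    case True
    moreover obtain c where "\<exists>m\<in>S. c m \<noteq> 0" "\<forall>e\<in>T. (\<Sum>m\<in>S. A e m * c m) = 0"
      using insert.IH[of S A] insert.prems insert.hyps by auto
    ultimately show ?thesis
      by (intro exI[of _ c]) auto
  next
    case False
    then obtain n where n: "n \<in> S" "A e n \<noteq> 0"
      by blast
    let ?S = "S - {n}"
    have "card T < card ?S"
      using insert.prems insert.hyps n by simp
    then obtain c where c: "\<exists>m\<in>?S. c m \<noteq> 0"
      "\<forall>e'\<in>T. (\<Sum>m\<in>?S. (A e' m - A e' n * A e m / A e n) * c m) = 0"
      using insert.IH[of ?S "\<lambda>e' m. A e' m - A e' n * A e m / A e n"] insert.prems by auto
    \<comment> \<open>The value at \<open>n\<close> is the one forced by equation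
      \<open>e\<close>.\<close>
    define d where "d = c(n := - (\<Sum>m\<in>?S. A e m * c m) / A e n)"
    have sum: "(\<Sum>m\<in>S. A e' m * d m) = (\<Sum>m\<in>?S. A e' m * c m) - A e' n * (\<Sum>m\<in>?S. A e m * c m) / A e n" for e'
    proof -
      have "(\<Sum>m\<in>S. A e' m * d m) = A e' n * d n + (\<Sum>m\<in>?S. A e' m * d m)"
        using insert.prems n by (intro sum.remove) auto
      also have "(\<Sum>m\<in>?S. A e' m * d m) = (\<Sum>m\<in>?S. A e' m * c m)"
        by (intro sum.cong) (auto simp: d_def)
      finally show ?thesis
        by (simp add: d_def)
    qed
    have "(\<Sum>m\<in>S. A e' m * d m) = 0" if "e' \<in> insert e T" for e'
    proof (cases "e' = e")
      case True
      then show ?thesis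
        using n by (simp add: sum)
    next
      case False
      then have "(\<Sum>m\<in>?S. (A e' m - A e' n * A e m / A e n) * c m) = 0"
        using that c(2) by blast
      then show ?thesis
        unfolding sum by (simp add: left_diff_distrib sum_subtractf sum_distrib_left sum_divide_distrib mult.assoc)
    qed
    moreover have "\<exists>m\<in>S. d m \<noteq> 0"
      using c(1) by (auto simp: d_def)
    ultimately show ?thesis
      by blast
  qed
qed

text \<open>\<open>K\<close> bounds the exponent of each variable separately, so that finitely many
  monomials are available. Real coefficients keep the later dependence relation real, although
  kernel vectors and zeros are complex.\<close>

inductive bounded_poly :: "'y set \<Rightarrow> nat \<Rightarrow> (('y \<Rightarrow> complex) \<Rightarrow> complex) \<Rightarrow> bool"
  for Y K where
  zero: "bounded_poly Y K (\<lambda>y. 0)"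
| add_monomial: "bounded_poly Y K F \<Longrightarrow> \<forall>i\<in>Y. e i \<le> K \<Longrightarrow>
    bounded_poly Y K (\<lambda>y. F y + complex_of_real c * (\<Prod>i\<in>Y. y i ^ e i))"

lemma bounded_poly_mono: "bounded_poly Y K F \<Longrightarrow> K \<le> L \<Longrightarrow> bounded_poly Y L F"
  by (induction rule: bounded_poly.induct) (auto intro!: bounded_poly.intros)

lemma bounded_poly_monomial:
  assumes "\<forall>i\<in>Y. e i \<le> K"
  shows "bounded_poly Y K (\<lambda>y. complex_of_real c * (\<Prod>i\<in>Y. y i ^ e i))"
  using bounded_poly.add_monomial[OF bounded_poly.zero assms, of c] by simp

lemma bounded_poly_const: "bounded_poly Y K (\<lambda>y. complex_of_real c)"
  using bounded_poly_monomial[of Y "\<lambda>_. 0" K c] by simp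

lemma bounded_poly_var:
  assumes "finite Y" "x \<in> Y" "1 \<le> K"
  shows "bounded_poly Y K (\<lambda>y. y x)"
proof -
  have "(\<Prod>i\<in>Y. y i ^ (if i = x then 1 else 0)) = y x" for y :: "_ \<Rightarrow> complex"
    using assms by (subst prod.remove[of _ x]) auto
  then show ?thesis
    using bounded_poly_monomial[of Y "\<lambda>i. if i = x then 1 else 0" K 1] assms by simp
qed

lemma bounded_poly_add:
  assumes "bounded_poly Y K F" "bounded_poly Y K G"
  shows "bounded_poly Y K (\<lambda>y. F y + G y)"
  using assms(2)
proof (induction rule: bounded_poly.induct)
  case (add_monomial G e c)
  then show ?case
    using bounded_poly.add_monomial[of Y K "\<lambda>y. F y + G y" e c] by (simp add: add.assoc)
qed (use assms(1) in simp)

lemma bounded_poly_mult: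
  assumes F: "bounded_poly Y K F" and G: "bounded_poly Y L G"
  shows "bounded_poly Y (K + L) (\<lambda>y. F y * G y)"
proof -
  have mono: "bounded_poly Y (K + L) (\<lambda>y. F y * (complex_of_real d * (\<Prod>i\<in>Y. y i ^ f i)))"
    if f: "\<forall>i\<in>Y. f i \<le> L" for d f
    using F
  proof (induction rule: bounded_poly.induct)
    case (add_monomial F e c)
    have "\<forall>i\<in>Y. e i + f i \<le> K + L"
      using add_monomial f by (auto intro: add_mono)
    from bounded_poly.add_monomial[OF add_monomial.IH this, of "c * d"] show ?case
      by (simp add: power_add prod.distrib algebra_simps)
  qed (simp add: bounded_poly.zero)
  show ?thesis
    using G
  proof (induction rule: bounded_poly.induct)
    case (add_monomial G e c)
    then show ?case
      using bounded_poly_add[OF add_monomial.IH mono, of e c] by (simp add: distrib_left)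
  qed (simp add: bounded_poly.zero)
qed

lemma bounded_poly_uminus: "bounded_poly Y K F \<Longrightarrow> bounded_poly Y K (\<lambda>y. - F y)"
  using bounded_poly_mult[OF bounded_poly_const[of Y 0 "- 1"], of K F] by simp

lemma bounded_poly_sum:
  "(\<And>i. i \<in> I \<Longrightarrow> bounded_poly Y K (F i)) \<Longrightarrow> bounded_poly Y K (\<lambda>y. \<Sum>i\<in>I. F i y)"
  by (induction I rule: infinite_finite_induct) (simp_all add: bounded_poly.zero bounded_poly_add)

lemma bounded_poly_power: "bounded_poly Y K F \<Longrightarrow> bounded_poly Y (n * K) (\<lambda>y. F y ^ n)"
proof (induction n)
  case 0
  show ?case
    using bounded_poly_const[of Y 0 1] by simp
next
  case (Suc n)
  then show ?case
    using bounded_poly_mult[of Y K F "n * K" "\<lambda>y. F y ^ n"] by simp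
qed

lemma bounded_poly_prod:
  assumes "finite I" "\<And>i. i \<in> I \<Longrightarrow> bounded_poly Y K (F i)"
  shows "bounded_poly Y (card I * K) (\<lambda>y. \<Prod>i\<in>I. F i y)"
  using assms
proof (induction I rule: finite_induct)
  case empty
  show ?case
    using bounded_poly_const[of Y 0 1] by simp
next
  case (insert i I)
  then show ?case
    using bounded_poly_mult[of Y K "F i" "card I * K" "\<lambda>y. \<Prod>i\<in>I. F i y"] by simp
qed

text \<open>One finite list of \<open>(K + 1) ^ card Y\<close> monomials serves all these functions,
  which makes linear algebra applicable.\<close>

lemma bounded_poly_coefficients:
  assumes "bounded_poly Y K F" "finite Y"
  shows "\<exists>A. \<forall>y. F y = (\<Sum>e\<in>Y \<rightarrow>\<^sub>E {..K}. complex_of_real (A e) * (\<Prod>i\<in>Y. y i ^ e i))"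
  using assms(1)
proof (induction rule: bounded_poly.induct)
  case zero
  show ?case
    by (intro exI[of _ "\<lambda>_. 0"]) simp
next
  case (add_monomial F e c)
  then obtain A where A: "\<And>y. F y = (\<Sum>e\<in>Y \<rightarrow>\<^sub>E {..K}. complex_of_real (A e) * (\<Prod>i\<in>Y. y i ^ e i))"
    by blast
  let ?e = "restrict e Y"
  have e: "?e \<in> Y \<rightarrow>\<^sub>E {..K}" "finite (Y \<rightarrow>\<^sub>E {..K})"
    using add_monomial.hyps assms(2) by (auto intro: finite_PiE)
  show ?case
  proof (intro exI[of _ "A(?e := A ?e + c)"] allI)
    fix y :: "'a \<Rightarrow> complex"
    have e_eq: "(\<Prod>i\<in>Y. y i ^ ?e i) = (\<Prod>i\<in>Y. y i ^ e i)"
      by (intro prod.cong) auto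
    have "(\<Sum>f\<in>Y \<rightarrow>\<^sub>E {..K}. complex_of_real ((A(?e := A ?e + c)) f) * (\<Prod>i\<in>Y. y i ^ f i)) =
        (\<Sum>f\<in>Y \<rightarrow>\<^sub>E {..K}. complex_of_real (A f) * (\<Prod>i\<in>Y. y i ^ f i)
          + (if f = ?e then complex_of_real c * (\<Prod>i\<in>Y. y i ^ ?e i) else 0))"
      by (intro sum.cong refl) (auto simp: distrib_right)
    also have "\<dots> = F y + complex_of_real c * (\<Prod>i\<in>Y. y i ^ e i)"
      using e by (simp add: sum.distrib A e_eq)
    finally show "F y + complex_of_real c * (\<Prod>i\<in>Y. y i ^ e i) =
        (\<Sum>f\<in>Y \<rightarrow>\<^sub>E {..K}. complex_of_real ((A(?e := A ?e + c)) f) * (\<Prod>i\<in>Y. y i ^ f i))"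
      by simp
  qed
qed

text \<open>The right side counts the products of powers up to \<open>d\<close> of \<open>N\<close>
  polynomials with exponents at most \<open>K\<close>; the left side counts the monomials in
  \<open>n\<close> variables that can occur in them.\<close>

lemma monomial_count_inequality:
  fixes n N K :: nat
  assumes "n < N"
  shows "\<exists>d. (N * (d * K) + 1) ^ n < (d + 1) ^ N"
proof -
  define C where "C = N * K + 1"
  \<comment> \<open>The constant factor \<open>C ^ n\<close> is then \<open>d\<close> itself, just
    below the extra factor \<open>d + 1\<close>.\<close>
  define d where "d = C ^ n"
  have "(N * (d * K) + 1) ^ n \<le> (C * (d + 1)) ^ n"
    by (intro power_mono) (auto simp: C_def algebra_simps)
  also have "\<dots> = d * (d + 1) ^ n"
    by (simp only: power_mult_distrib d_def)
  also have "\<dots> < (d + 1) * (d + 1) ^ n"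
    by simp
  also have "\<dots> = (d + 1) ^ Suc n"
    by simp
  also have "\<dots> \<le> (d + 1) ^ N"
    using assms by (intro power_increasing) auto
  finally show ?thesis ..
qed

text \<open>Products of powers of the \<open>\<Phi> x\<close> with exponents at most
  \<open>d\<close> expand in monomials over \<open>Y\<close> with exponents at most
  \<open>L\<close>. For suitable \<open>d\<close> there are fewer such monomials than products, so
  the products satisfy a nontrivial real linear relation, whose coefficients define
  \<open>g\<close>.\<close>

lemma algebraic_dependence:
  fixes \<Phi> :: "'x \<Rightarrow> ('y \<Rightarrow> complex) \<Rightarrow> complex"
  assumes "finite X" "finite Y" "card Y < card X"
    and \<Phi>: "\<And>x. x \<in> X \<Longrightarrow> bounded_poly Y K (\<Phi> x)"
  shows "\<exists>g. poly_fun X g \<and> (\<exists>a. g a \<noteq> 0) \<and>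
    (\<forall>a y. (\<forall>x\<in>X. complex_of_real (a x) = \<Phi> x y) \<longrightarrow> g a = 0)"
proof -
  obtain d where d: "(card X * (d * K) + 1) ^ card Y < (d + 1) ^ card X"
    using monomial_count_inequality[OF assms(3)] by blast
  define L where "L = card X * (d * K)"
  let ?M = "X \<rightarrow>\<^sub>E {..d}" and ?E = "Y \<rightarrow>\<^sub>E {..L}"
  have "\<forall>m\<in>?M. \<exists>A. \<forall>y. (\<Prod>x\<in>X. \<Phi> x y ^ m x) =
      (\<Sum>e\<in>?E. complex_of_real (A e) * (\<Prod>i\<in>Y. y i ^ e i))"
  proof (intro ballI bounded_poly_coefficients assms(2))
    fix m assume m: "m \<in> ?M"
    have "bounded_poly Y (d * K) (\<lambda>y. \<Phi> x y ^ m x)" if "x \<in> X" for x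
    proof -
      have "m x \<le> d"
        using m that by auto
      then show ?thesis
        by (intro bounded_poly_mono[OF bounded_poly_power[OF \<Phi>[OF that]]] mult_right_mono) auto
    qed
    then show "bounded_poly Y L (\<lambda>y. \<Prod>x\<in>X. \<Phi> x y ^ m x)"
      unfolding L_def using assms(1) by (intro bounded_poly_prod)
  qed
  from bchoice[OF this] obtain A where A: "\<And>m y. m \<in> ?M \<Longrightarrow>
      (\<Prod>x\<in>X. \<Phi> x y ^ m x) = (\<Sum>e\<in>?E. complex_of_real (A m e) * (\<Prod>i\<in>Y. y i ^ e i))"
    by blast
  have "card ?E < card ?M"
    using d assms(1,2) by (simp add: card_PiE L_def)
  then have "\<exists>c. (\<exists>m\<in>?M. c m \<noteq> 0) \<and> (\<forall>e\<in>?E. (\<Sum>m\<in>?M. A m e * c m) = 0)"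
    using assms(1,2) by (intro homogeneous_system_nontrivial_solution finite_PiE) auto
  then obtain c m0 where c: "m0 \<in> ?M" "c m0 \<noteq> 0" "\<And>e. e \<in> ?E \<Longrightarrow> (\<Sum>m\<in>?M. A m e * c m) = 0"
    by blast
  define g where "g a = (\<Sum>m\<in>?M. c m * (\<Prod>x\<in>X. a x ^ m x))" for a :: "'x \<Rightarrow> real"
  have "poly_fun X g"
    unfolding g_def
    by (intro poly_fun_sum poly_fun_mult poly_fun_const poly_fun_prod poly_fun_power poly_fun_var)
  \<comment> \<open>Extensional functions on \<open>X\<close> are determined by their values on
    \<open>X\<close>, so distinct terms of \<open>g\<close> have distinct exponent vectors.\<close>
  moreover have "inj_on (\<lambda>m. restrict m X) ?M"
    by (auto simp: inj_on_def PiE_def extensional_restrict)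
  then have "\<exists>a. g a \<noteq> 0"
    unfolding g_def using assms(1) c(1,2)
    by (intro nonzero_polynomial_has_nonroot[of X ?M m0 c] finite_PiE) auto
  moreover have "g a = 0" if a: "\<forall>x\<in>X. complex_of_real (a x) = \<Phi> x y" for a y
  proof -
    have "complex_of_real (g a) = (\<Sum>m\<in>?M. complex_of_real (c m) * (\<Prod>x\<in>X. \<Phi> x y ^ m x))"
      unfolding g_def using a by simp
    also have "\<dots> = (\<Sum>m\<in>?M. \<Sum>e\<in>?E. complex_of_real (A m e * c m) * (\<Prod>i\<in>Y. y i ^ e i))"
      by (intro sum.cong refl) (simp add: A sum_distrib_left mult_ac)
    also have "\<dots> = (\<Sum>e\<in>?E. complex_of_real (\<Sum>m\<in>?M. A m e * c m) * (\<Prod>i\<in>Y. y i ^ e i))"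
      by (subst sum.swap) (simp add: sum_distrib_right)
    also have "\<dots> = 0"
      using c(3) by simp
    finally show ?thesis
      by simp
  qed
  ultimately show ?thesis
    by blast
qed

section \<open>Matchings and nonredundant entries\<close>

text \<open>Edges of a matching have distinct rows, so \<open>CARD('p)\<close> of them reach every
  row and define a function; distinct columns make it injective.\<close>

lemma R_saturating_graph:
  fixes E :: "('p::finite \<times> 'v::finite) set"
  assumes "R_saturating E m"
  obtains \<sigma> where "inj \<sigma>" "m = range (\<lambda>i. (i, \<sigma> i))"
proof -
  have m: "\<And>e e'. e \<in> m \<Longrightarrow> e' \<in> m \<Longrightarrow> fst e = fst e' \<or> snd e = snd e' \<Longrightarrow> e = e'" "card m = CARD('p)"
    using assms unfolding R_saturating_def matching_def by blast+
  have "inj_on fst m"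
    using m(1) by (auto intro!: inj_onI)
  then have "card (fst ` m) = CARD('p)"
    using m(2) by (simp add: card_image)
  then have "fst ` m = UNIV"
    by (intro card_subset_eq) auto
  then have "\<exists>j. (i, j) \<in> m" for i
    by (metis UNIV_I imageE prod.collapse)
  then obtain \<sigma> where \<sigma>: "\<And>i. (i, \<sigma> i) \<in> m"
    by metis
  have "inj \<sigma>"
  proof (rule injI)
    fix i k assume "\<sigma> i = \<sigma> k"
    then have "(i, \<sigma> i) = (k, \<sigma> k)"
      by (intro m(1) \<sigma>) simp
    then show "i = k"
      by simp
  qed
  moreover have "m = range (\<lambda>i. (i, \<sigma> i))"
  proof
    show "m \<subseteq> range (\<lambda>i. (i, \<sigma> i))"
    proof
      fix e assume "e \<in> m"
      from m(1)[OF this \<sigma>[of "fst e"]] have "e = (fst e, \<sigma> (fst e))"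
        by simp
      then show "e \<in> range (\<lambda>i. (i, \<sigma> i))"
        by (rule range_eqI)
    qed
  qed (use \<sigma> in auto)
  ultimately show thesis
    by (rule that)
qed

lemma R_saturating_graphI:
  fixes E :: "('p::finite \<times> 'v::finite) set"
  assumes "inj \<sigma>" "\<And>i. (i, \<sigma> i) \<in> E"
  shows "R_saturating E (range (\<lambda>i. (i, \<sigma> i)))"
proof -
  have "card (range (\<lambda>i. (i, \<sigma> i))) = CARD('p)"
    by (intro card_image injI) simp
  then show ?thesis
    using assms by (auto simp: R_saturating_def matching_def dest: injD)
qed

lemma R_saturating_nonredundant: "R_saturating E m \<Longrightarrow> e \<in> m \<Longrightarrow> e \<in> nonredundant_edges E"
  unfolding nonredundant_edges_def redundant_def R_saturating_def matching_def by blast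

lemma nonredundant_edge_in_matching:
  assumes "e \<in> nonredundant_edges E"
  obtains m where "R_saturating E m" "e \<in> m"
  using assms unfolding nonredundant_edges_def redundant_def by blast

lemma nonredundant_edges_subset: "nonredundant_edges E \<subseteq> E"
  unfolding nonredundant_edges_def by blast

section \<open>The nonredundant part of a matrix and its maximal minors\<close>

definition restrict_entries :: "('p \<times> 'v) set \<Rightarrow> 'a::zero ^ 'v ^ 'p \<Rightarrow> 'a ^ 'v ^ 'p" where
  "restrict_entries E A = (\<chi> i j. if (i, j) \<in> E then A $ i $ j else 0)"

lemma restrict_entries_nth: "restrict_entries E A $ i $ j = (if (i, j) \<in> E then A $ i $ j else 0)"
  by (simp add: restrict_entries_def)

lemma det_select_cols_restrict_entries:
  fixes A :: "'a::field ^ 'v ^ 'p"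
  assumes E: "\<And>i j. (i, j) \<notin> E \<Longrightarrow> A $ i $ j = 0"
  shows "det (select_cols \<sigma> (restrict_entries (nonredundant_edges E) A)) = det (select_cols \<sigma> A)"
proof (cases "inj \<sigma>")
  case False
  then obtain i k where ik: "i \<noteq> k" "\<sigma> i = \<sigma> k"
    by (auto simp: inj_def)
  have "det (select_cols \<sigma> B) = 0" for B :: "'a ^ 'v ^ 'p"
    using ik by (intro det_identical_columns[of i k]) (auto simp: column_def select_cols_def)
  then show ?thesis
    by simp
next
  case True
  show ?thesis
    unfolding det_def
  proof (intro sum.cong refl)
    fix p :: "'p \<Rightarrow> 'p" assume "p \<in> {p. p permutes UNIV}"
    then have inj: "inj (\<sigma> \<circ> p)"
      using True permutes_inj by (auto intro: inj_compose)
    \<comment> \<open>If all \<open>(i, \<sigma> (p i))\<close> are edges, they form an R-saturating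
      matching, so none is redundant; otherwise the term is zero in both matrices.\<close>
    have "(\<Prod>i\<in>UNIV. select_cols \<sigma> (restrict_entries (nonredundant_edges E) A) $ i $ p i) =
        (\<Prod>i\<in>UNIV. select_cols \<sigma> A $ i $ p i)"
    proof (cases "\<forall>i. (i, \<sigma> (p i)) \<in> E")
      case True
      then have "(i, \<sigma> (p i)) \<in> nonredundant_edges E" for i
        using R_saturating_nonredundant[OF R_saturating_graphI[of "\<sigma> \<circ> p" E]] inj by auto
      then show ?thesis
        by (simp add: select_cols_def restrict_entries_nth)
    next
      case False
      then obtain i where "(i, \<sigma> (p i)) \<notin> E"
        by blast
      then have "select_cols \<sigma> A $ i $ p i = 0" "select_cols \<sigma> (restrict_entries (nonredundant_edges E) A) $ i $ p i = 0"
        using E by (auto simp: select_cols_def restrict_entries_nth)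
      then show ?thesis
        by (metis (no_types, lifting) UNIV_I finite prod_zero)
    qed
    then show "of_int (sign p) * (\<Prod>i\<in>UNIV. select_cols \<sigma> (restrict_entries (nonredundant_edges E) A) $ i $ p i) =
        of_int (sign p) * (\<Prod>i\<in>UNIV. select_cols \<sigma> A $ i $ p i)"
      by simp
  qed
qed

text \<open>Only full rank transfers: deleting redundant entries can change a rank that is already
  deficient.\<close>

lemma rank_restrict_entries_full:
  fixes A :: "'a::field ^ 'v ^ 'p"
  assumes "\<And>i j. (i, j) \<notin> E \<Longrightarrow> A $ i $ j = 0"
  shows "rank (restrict_entries (nonredundant_edges E) A) = CARD('p) \<longleftrightarrow> rank A = CARD('p)"
  by (simp add: rank_full_iff_nonzero_minor det_select_cols_restrict_entries[OF assms])

lemma rank_le_rows: "rank (A :: 'a::field ^ 'v ^ 'p) \<le> CARD('p)"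
proof -
  have "vec.dim (rows A) \<le> card (rows A)"
    by (rule vec.dim_le_card) (auto simp: rows_def full_SetCompr_eq intro: vec.span_base)
  also have "\<dots> \<le> CARD('p)"
    unfolding rows_def Setcompr_eq_image by (rule card_image_le) simp
  finally show ?thesis
    by (simp add: row_rank_def_gen)
qed

section \<open>Evaluation of real polynomials at complex points\<close>

definition cpoly :: "real poly \<Rightarrow> complex \<Rightarrow> complex" where
  "cpoly q z = poly (map_poly complex_of_real q) z"

lemma cpoly_0: "cpoly 0 z = 0"
  by (simp add: cpoly_def)

lemma cpoly_pCons: "cpoly (pCons a q) z = complex_of_real a + z * cpoly q z"
  by (cases "a = 0 \<and> q = 0") (auto simp: cpoly_def map_poly_pCons)

lemma cpoly_1: "cpoly 1 z = 1"
  by (simp add: cpoly_def)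

lemma cpoly_add: "cpoly (p + q) z = cpoly p z + cpoly q z"
  by (induction p q rule: poly_induct2) (simp_all add: cpoly_0 cpoly_pCons algebra_simps)

lemma cpoly_smult: "cpoly (smult a q) z = complex_of_real a * cpoly q z"
  by (induction q) (simp_all add: cpoly_0 cpoly_pCons algebra_simps)

lemma cpoly_mult: "cpoly (p * q) z = cpoly p z * cpoly q z"
  by (induction p) (simp_all add: cpoly_0 cpoly_pCons cpoly_add cpoly_smult algebra_simps)

lemma cpoly_sum: "cpoly (\<Sum>i\<in>I. p i) z = (\<Sum>i\<in>I. cpoly (p i) z)"
  by (induction I rule: infinite_finite_induct) (simp_all add: cpoly_0 cpoly_add)

lemma cpoly_monom: "cpoly (monom c n) z = complex_of_real c * z ^ n"
  by (simp add: cpoly_def map_poly_monom poly_monom)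

lemma cpoly_of_real: "cpoly q (complex_of_real t) = complex_of_real (poly q t)"
  by (induction q) (simp_all add: cpoly_0 cpoly_pCons)

lemma eval_matrix_nth: "eval_matrix M z $ i $ j = cpoly (M $ i $ j) z"
  by (simp add: eval_matrix_def cpoly_def)

lemma eval_family_matrix_nth:
  "eval_matrix (family_matrix M a) z $ i $ j =
    (if (i, j) \<in> edges M then \<Sum>k\<le>weight M (i, j). complex_of_real (a (i, j, k)) * z ^ k else 0)"
  by (simp add: eval_matrix_nth family_matrix_def cpoly_sum cpoly_monom cpoly_0)

lemma finite_params: "finite (params (M :: real poly ^ 'v ^ 'p))"
proof -
  have "params M \<subseteq> (\<Union>e\<in>UNIV. (\<lambda>k. (fst e, snd e, k)) ` {..weight M e})"
    by (force simp: params_def)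
  then show ?thesis
    by (rule finite_subset) auto
qed

lemma family_matrix_cong:
  assumes "\<And>q. q \<in> params M \<Longrightarrow> a q = b q"
  shows "family_matrix M a = family_matrix M b"
  unfolding family_matrix_def using assms by (auto simp: vec_eq_iff params_def intro!: sum.cong)

section \<open>Sufficiency\<close>

text \<open>Handles the kernel vectors with support exactly \<open>r\<close>: no component on
  \<open>r\<close> vanishes, so each column equation can be divided by its pivot component. The
  parameters are then a polynomial image of fewer variables, and \<open>algebraic_dependence\<close>
  applies.\<close>

lemma left_kernel_elimination_polynomial:
  fixes M :: "real poly ^ 'v ^ 'p"
  defines "E' \<equiv> nonredundant_edges (edges M)"
  assumes r: "r \<noteq> {}" and hall: "card r \<le> card (E' `` r)"
    and weights: "card r = card (E' `` r) \<Longrightarrow> \<forall>e\<in>E'. fst e \<in> r \<longrightarrow> weight M e = 0"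
  shows "\<exists>g. poly_fun (params M) g \<and> (\<exists>a. g a \<noteq> 0) \<and>
    (\<forall>a x z. (\<forall>i. x i \<noteq> 0 \<longleftrightarrow> i \<in> r) \<and>
       (\<forall>j. (\<Sum>i\<in>UNIV. x i * restrict_entries E' (eval_matrix (family_matrix M a) z) $ i $ j) = 0) \<longrightarrow> g a = 0)"
proof -
  let ?P = "params M"
  define N where "N = E' `` r"
  have E'_edges: "E' \<subseteq> edges M"
    unfolding E'_def by (rule nonredundant_edges_subset)
  obtain i0 where i0: "i0 \<in> r"
    using r by blast
  have "\<forall>j\<in>N. \<exists>i. i \<in> r \<and> (i, j) \<in> E'"
    by (auto simp: N_def)
  from bchoice[OF this] obtain \<iota> where \<iota>: "\<And>j. j \<in> N \<Longrightarrow> \<iota> j \<in> r \<and> (\<iota> j, j) \<in> E'"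
    by blast
  \<comment> \<open>The pivots: the constant coefficients solved for, one in each column adjacent to \<open>r\<close>.\<close>
  define T where "T = (\<lambda>j. (\<iota> j, j, 0 :: nat)) ` N"
  have T_P: "T \<subseteq> ?P"
    using \<iota> E'_edges by (auto simp: T_def params_def)
  have card_T: "card T = card N"
    unfolding T_def by (intro card_image inj_onI) simp
  \<comment> \<open>In the flat case \<open>z\<close> does not enter the column equations and needs
    no variable.\<close>
  define flat where "flat \<longleftrightarrow> (\<forall>e\<in>E'. fst e \<in> r \<longrightarrow> weight M e = 0)"
  define L :: "'p option set" where "L = (if flat then {} else {None})"
  \<comment> \<open>The variables \<open>Some i\<close> stand for the kernel vector normalised by \<open>x i0 = 1\<close>, \<open>None\<close> for the
    point \<open>z\<close>, and the triples for the free coefficients.\<close>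
  define Y :: "('p option + 'p \<times> 'v \<times> nat) set" where
    "Y = Inl ` (Some ` (r - {i0}) \<union> L) \<union> Inr ` (?P - T)"
  have fin: "finite ?P" "finite Y" "finite L"
    by (auto simp: Y_def L_def finite_params)
  have card_Y: "card Y < card ?P"
  proof -
    have "card Y = card (Some ` (r - {i0}) \<union> L) + card (?P - T)"
      unfolding Y_def using fin(1,3)
      by (subst card_Un_disjoint) (auto simp: card_image)
    also have "card (Some ` (r - {i0}) \<union> L) = (card r - 1) + card L"
      using i0 by (subst card_Un_disjoint) (auto simp: L_def card_image)
    also have "card (?P - T) = card ?P - card N"
      using T_P fin(1) by (simp add: card_Diff_subset finite_subset card_T)
    finally have Y: "card Y = (card r - 1) + card L + (card ?P - card N)" .
    \<comment> \<open>Positivity and the next bound make the natural subtractions exact. If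
      \<open>card r = card N\<close>, there is no variable for \<open>z\<close>; otherwise
      \<open>card N > card r\<close> makes room for it.\<close>
    have "0 < card r"
      using i0 by (auto simp: card_gt_0_iff)
    moreover have "card N \<le> card ?P"
      using card_mono[OF fin(1) T_P] card_T by simp
    moreover have "card L \<le> 1" "flat \<Longrightarrow> card L = 0"
      by (auto simp: L_def)
    moreover have "card r = card N \<Longrightarrow> flat"
      using weights by (simp add: N_def flat_def)
    ultimately show ?thesis
      using Y hall unfolding N_def[symmetric] by (cases "card r = card N") auto
  qed
  define X where "X i y = (if i = i0 then 1 else y (Inl (Some i)))"
    for i and y :: "'p option + 'p \<times> 'v \<times> nat \<Rightarrow> complex"
  \<comment> \<open>The value 1 is a placeholder: in the flat case only the exponent 0
    occurs.\<close>
  define \<Lambda> where "\<Lambda> y = (if flat then 1 else y (Inl None))"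
    for y :: "'p option + 'p \<times> 'v \<times> nat \<Rightarrow> complex"
  define Q where "Q j = {q \<in> ?P. fst (snd q) = j \<and> fst q \<in> r \<and> (fst q, j) \<in> E'}" for j
  \<comment> \<open>The free coefficients of column \<open>j\<close> are scaled by the pivot component of the kernel vector,
    so that solving for the pivot needs no division.\<close>
  define \<Phi> where "\<Phi> q y = (if q \<in> T
      then - (\<Sum>q'\<in>Q (fst (snd q)) - T. X (fst q') y * y (Inr q') * \<Lambda> y ^ snd (snd q'))
      else (if fst (snd q) \<in> N then X (\<iota> (fst (snd q))) y else 1) * y (Inr q))"
    for q :: "'p \<times> 'v \<times> nat" and y
  \<comment> \<open>A crude bound on the degree index of every parameter.\<close>
  define W where "W = (\<Sum>q\<in>?P. snd (snd q))"
  have X_poly: "bounded_poly Y 1 (X i)" if "i \<in> r" for i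
  proof (cases "i = i0")
    case True
    then have "X i = (\<lambda>y. complex_of_real 1)"
      by (auto simp: X_def)
    then show ?thesis
      by (simp only: bounded_poly_const)
  next
    case False
    then have "X i = (\<lambda>y. y (Inl (Some i)))"
      by (auto simp: X_def)
    then show ?thesis
      using fin that False by (auto simp: Y_def intro!: bounded_poly_var)
  qed
  have \<Lambda>_poly: "bounded_poly Y 1 \<Lambda>"
  proof (cases flat)
    case True
    then have "\<Lambda> = (\<lambda>y. complex_of_real 1)"
      by (auto simp: \<Lambda>_def)
    then show ?thesis
      by (simp only: bounded_poly_const)
  next
    case False
    then have "\<Lambda> = (\<lambda>y. y (Inl None))"
      by (auto simp: \<Lambda>_def)
    then show ?thesis
      using fin False by (auto simp: Y_def L_def intro!: bounded_poly_var)
  qed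
  have b_poly: "bounded_poly Y 1 (\<lambda>y. y (Inr q))" if "q \<in> ?P - T" for q
    using fin that by (intro bounded_poly_var) (auto simp: Y_def)
  have \<Phi>_poly: "bounded_poly Y (2 + W) (\<Phi> q)" if q: "q \<in> ?P" for q
  proof (cases "q \<in> T")
    case True
    have "bounded_poly Y (2 + W) (\<lambda>y. X (fst q') y * y (Inr q') * \<Lambda> y ^ snd (snd q'))"
      if q': "q' \<in> Q (fst (snd q)) - T" for q'
    proof (rule bounded_poly_mono)
      show "bounded_poly Y (1 + 1 + snd (snd q') * 1) (\<lambda>y. X (fst q') y * y (Inr q') * \<Lambda> y ^ snd (snd q'))"
        using q' by (intro bounded_poly_mult bounded_poly_power X_poly \<Lambda>_poly b_poly) (auto simp: Q_def)
      have "snd (snd q') \<le> W"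
        unfolding W_def using q' fin(1) by (intro member_le_sum) (auto simp: Q_def)
      then show "1 + 1 + snd (snd q') * 1 \<le> 2 + W"
        by simp
    qed
    moreover have "\<Phi> q = (\<lambda>y. - (\<Sum>q'\<in>Q (fst (snd q)) - T. X (fst q') y * y (Inr q') * \<Lambda> y ^ snd (snd q')))"
      using True by (auto simp: \<Phi>_def)
    ultimately show ?thesis
      by (simp only:) (intro bounded_poly_uminus bounded_poly_sum)
  next
    case False
    show ?thesis
    proof (cases "fst (snd q) \<in> N")
      case True
      have "bounded_poly Y (1 + 1) (\<lambda>y. X (\<iota> (fst (snd q))) y * y (Inr q))"
        using \<iota>[OF True] False q by (intro bounded_poly_mult X_poly b_poly) auto
      moreover have "\<Phi> q = (\<lambda>y. X (\<iota> (fst (snd q))) y * y (Inr q))"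
        using True False by (auto simp: \<Phi>_def)
      ultimately show ?thesis
        by (auto intro: bounded_poly_mono)
    next
      case N: False
      have "\<Phi> q = (\<lambda>y. y (Inr q))"
        using N False by (auto simp: \<Phi>_def)
      then show ?thesis
        using b_poly[of q] q False by (auto intro: bounded_poly_mono)
    qed
  qed
  obtain g where g: "poly_fun ?P g" "\<exists>a. g a \<noteq> 0"
    "\<And>a y. \<forall>q\<in>?P. complex_of_real (a q) = \<Phi> q y \<Longrightarrow> g a = 0"
    using algebraic_dependence[of ?P Y "2 + W" \<Phi>, OF fin(1,2) card_Y \<Phi>_poly] by blast
  have "g a = 0" if x: "\<And>i. x i \<noteq> 0 \<longleftrightarrow> i \<in> r"
    and ker: "\<And>j. (\<Sum>i\<in>UNIV. x i * restrict_entries E' (eval_matrix (family_matrix M a) z) $ i $ j) = 0" for a x z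
  proof -
    \<comment> \<open>Kernel data give the preimage \<open>y\<close>: \<open>u\<close> is the vector
      scaled to 1 at \<open>i0\<close>, and \<open>b\<close> divides out the factor by which
      \<open>\<Phi>\<close> multiplies free coefficients.\<close>
    define u where "u i = x i / x i0" for i
    define b where "b q = (if fst (snd q) \<in> N then complex_of_real (a q) / u (\<iota> (fst (snd q))) else complex_of_real (a q))" for q
    define y where "y s = (case s of Inl None \<Rightarrow> z | Inl (Some i) \<Rightarrow> u i | Inr q \<Rightarrow> b q)" for s
    have u0: "u i \<noteq> 0 \<longleftrightarrow> i \<in> r" for i
      using x i0 by (simp add: u_def)
    have X: "X i y = u i" for i
      using x i0 by (auto simp: X_def y_def u_def)
    have \<Lambda>: "\<Lambda> y ^ snd (snd q) = z ^ snd (snd q)" if "q \<in> Q j" for q j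
    proof (cases flat)
      case True
      then have "snd (snd q) = 0"
        using that by (auto simp: flat_def Q_def params_def)
      then show ?thesis
        by simp
    qed (simp add: \<Lambda>_def y_def)
    \<comment> \<open>The equation of column \<open>j\<close> as one sum over single coefficients
      instead of entries.\<close>
    have col: "(\<Sum>q\<in>Q j. u (fst q) * complex_of_real (a q) * z ^ snd (snd q)) = 0" for j
    proof -
      let ?I = "{i \<in> r. (i, j) \<in> E'}"
      have Q_eq: "Q j = (\<lambda>(i, k). (i, j, k)) ` (SIGMA i:?I. {..weight M (i, j)})"
        using E'_edges by (force simp: Q_def params_def)
      have "(\<Sum>q\<in>Q j. u (fst q) * complex_of_real (a q) * z ^ snd (snd q)) =
          (\<Sum>(i, k)\<in>(SIGMA i:?I. {..weight M (i, j)}). u i * complex_of_real (a (i, j, k)) * z ^ k)"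
        unfolding Q_eq by (subst sum.reindex) (auto simp: inj_on_def intro!: sum.cong)
      also have "\<dots> = (\<Sum>i\<in>?I. \<Sum>k\<le>weight M (i, j). u i * complex_of_real (a (i, j, k)) * z ^ k)"
        by (subst sum.Sigma) auto
      also have "\<dots> = (\<Sum>i\<in>?I. u i * restrict_entries E' (eval_matrix (family_matrix M a) z) $ i $ j)"
        using E'_edges
        by (intro sum.cong refl) (auto simp: restrict_entries_nth eval_family_matrix_nth sum_distrib_left mult.assoc)
      also have "\<dots> = (\<Sum>i\<in>UNIV. u i * restrict_entries E' (eval_matrix (family_matrix M a) z) $ i $ j)"
        using u0 by (intro sum.mono_neutral_left) (auto simp: restrict_entries_nth)
      also have "\<dots> = (\<Sum>i\<in>UNIV. x i * restrict_entries E' (eval_matrix (family_matrix M a) z) $ i $ j) / x i0"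
        by (simp add: u_def sum_divide_distrib)
      finally show ?thesis
        using ker by simp
    qed
    have "complex_of_real (a q) = \<Phi> q y" if q: "q \<in> ?P" for q
    proof (cases "q \<in> T")
      case False
      then show ?thesis
        using \<iota> u0 by (auto simp: \<Phi>_def X y_def b_def)
    next
      case True
      then obtain j where j: "j \<in> N" "q = (\<iota> j, j, 0)"
        by (auto simp: T_def)
      have uj: "u (\<iota> j) \<noteq> 0"
        using \<iota>[OF j(1)] u0 by blast
      have fQ: "finite (Q j)" and qQ: "q \<in> Q j" and QT: "Q j - T = Q j - {q}"
        using fin(1) q j \<iota>[OF j(1)] by (auto simp: Q_def T_def)
      \<comment> \<open>The pivot has exponent 0, so it appears without a power of
        \<open>z\<close>.\<close>
      have "0 = u (\<iota> j) * complex_of_real (a q)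
          + (\<Sum>q\<in>Q j - {q}. u (fst q) * complex_of_real (a q) * z ^ snd (snd q))"
        using col[of j] sum.remove[OF fQ qQ, of "\<lambda>q. u (fst q) * complex_of_real (a q) * z ^ snd (snd q)"] j(2)
        by simp
      then have "complex_of_real (a q)
          = - (\<Sum>q\<in>Q j - {q}. u (fst q) * complex_of_real (a q) * z ^ snd (snd q)) / u (\<iota> j)"
        using uj by (simp add: field_simps add_eq_0_iff)
      \<comment> \<open>In column \<open>j\<close> the quotient of \<open>a q'\<close> by
        \<open>u (\<iota> j)\<close> is \<open>b q'\<close>.\<close>
      also have "\<dots> = - (\<Sum>q'\<in>Q j - {q}. u (fst q') * b q' * z ^ snd (snd q'))"
        unfolding sum_divide_distrib minus_divide_left[symmetric]
        using j(1) by (intro arg_cong[where f = uminus] sum.cong refl) (auto simp: b_def Q_def)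
      also have "\<dots> = - (\<Sum>q'\<in>Q j - {q}. X (fst q') y * y (Inr q') * \<Lambda> y ^ snd (snd q'))"
        by (intro arg_cong[where f = uminus] sum.cong refl) (simp add: X \<Lambda>[of _ j] y_def)
      also have "\<dots> = \<Phi> q y"
        using True j(2) by (simp add: \<Phi>_def QT)
      finally show ?thesis .
    qed
    then show ?thesis
      by (intro g(3)[of a y]) blast
  qed
  then show ?thesis
    using g(1,2) by blast
qed

text \<open>A zero forces a left kernel vector of the nonredundant part. Its support is one of
  finitely many nonempty sets, so the product of their elimination polynomials vanishes.\<close>

lemma generically_no_zeros:
  fixes M :: "real poly ^ 'v ^ 'p"
  assumes sat: "\<exists>m. R_saturating (edges M) m" and P: "property_P (edges M) (weight M)"
  shows "generically M (\<lambda>M'. zeros M' = {})"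
proof -
  let ?E' = "nonredundant_edges (edges M)"
  define bad where "bad r a \<longleftrightarrow> (\<exists>x z. (\<forall>i. x i \<noteq> 0 \<longleftrightarrow> i \<in> r) \<and>
       (\<forall>j. (\<Sum>i\<in>UNIV. x i * restrict_entries ?E' (eval_matrix (family_matrix M a) z) $ i $ j) = 0))" for r a
  obtain m where m: "R_saturating (edges M) m"
    using sat by blast
  have hall: "m `` r \<subseteq> ?E' `` r \<and> card (m `` r) = card r" if m: "R_saturating (edges M) m" for m r
  proof -
    obtain \<sigma> where \<sigma>: "inj \<sigma>" "m = range (\<lambda>i. (i, \<sigma> i))"
      using m by (rule R_saturating_graph)
    have "m `` r = \<sigma> ` r"
      by (auto simp: \<sigma>(2))
    moreover have "card (\<sigma> ` r) = card r"
      by (intro card_image inj_on_subset[OF \<sigma>(1)]) auto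
    moreover have "m \<subseteq> ?E'"
      using R_saturating_nonredundant[OF m] by blast
    ultimately show ?thesis
      by auto
  qed
  have "\<forall>r\<in>Pow UNIV - {{}}. \<exists>g. poly_fun (params M) g \<and> (\<exists>a. g a \<noteq> 0) \<and> (\<forall>a. bad r a \<longrightarrow> g a = 0)"
  proof
    fix r :: "'p set" assume r: "r \<in> Pow UNIV - {{}}"
    have le: "card r \<le> card (?E' `` r)"
      using hall[OF m, of r] card_mono[of "?E' `` r" "m `` r"] by simp
    \<comment> \<open>With equality, each matching sends \<open>r\<close> onto its whole
      neighbourhood, so (P) applies with that neighbourhood as \<open>c\<close>.\<close>
    have "\<forall>e\<in>?E'. fst e \<in> r \<longrightarrow> weight M e = 0" if eq: "card r = card (?E' `` r)"
    proof -
      have "matches m' r (?E' `` r)" if "R_saturating (edges M) m'" for m'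
        unfolding matches_def using hall[OF that, of r] eq by (intro card_subset_eq) auto
      then show ?thesis
        using P eq unfolding property_P_def by blast
    qed
    from left_kernel_elimination_polynomial[OF _ le this] r
    show "\<exists>g. poly_fun (params M) g \<and> (\<exists>a. g a \<noteq> 0) \<and> (\<forall>a. bad r a \<longrightarrow> g a = 0)"
      unfolding bad_def by blast
  qed
  from bchoice[OF this] obtain g where g: "\<And>r. r \<in> Pow UNIV - {{}} \<Longrightarrow>
      poly_fun (params M) (g r) \<and> (\<exists>a. g r a \<noteq> 0) \<and> (\<forall>a. bad r a \<longrightarrow> g r a = 0)"
    by blast
  define G where "G a = (\<Prod>r\<in>Pow UNIV - {{}}. g r a)" for a
  have "poly_fun (params M) G"
    unfolding G_def using g by (intro poly_fun_prod) blast
  then obtain f where f: "mpoly_vars f \<subseteq> params M" "\<And>a. mpoly_eval f a = G a"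
    unfolding poly_fun_def by blast
  obtain a1 where "G a1 \<noteq> 0"
    unfolding G_def using prod_poly_fun_nonzero[of "Pow UNIV - {{}}" "params M" g] g by auto
  then have "f \<noteq> 0"
    using f(2)[of a1] by (auto simp: mpoly_eval_def)
  moreover have "mpoly_eval f a = 0" if nonempty: "zeros (family_matrix M a) \<noteq> {}" for a
  proof -
    let ?A = "\<lambda>z. eval_matrix (family_matrix M a) z"
    obtain z where "rank (?A z) < poly_rank (family_matrix M a)"
      using nonempty by (auto simp: zeros_def)
    \<comment> \<open>The rank as a polynomial matrix is at most \<open>CARD('p)\<close>, so any
      drop loses full rank.\<close>
    then have "rank (?A z) \<noteq> CARD('p)"
      using rank_le_rows[of "map_matrix to_fract (family_matrix M a)"] by (simp add: poly_rank_def)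
    then have "rank (restrict_entries ?E' (?A z)) \<noteq> CARD('p)"
      by (subst rank_restrict_entries_full) (auto simp: eval_family_matrix_nth)
    then obtain x i where x: "\<forall>j. (\<Sum>i\<in>UNIV. x i * restrict_entries ?E' (?A z) $ i $ j) = 0" "x i \<noteq> 0"
      unfolding rank_full_iff_independent_rows by blast
    define r where "r = {i. x i \<noteq> 0}"
    have r: "r \<in> Pow UNIV - {{}}"
      using x(2) by (auto simp: r_def)
    have "bad r a"
      unfolding bad_def r_def using x(1) by blast
    then have "g r a = 0"
      using g[OF r] by blast
    then show ?thesis
      unfolding f(2) G_def using r by (intro prod_zero) auto
  qed
  ultimately show ?thesis
    unfolding generically_def using f(1) by blast
qed

section \<open>Necessity\<close>

lemma det_0_left_kernel:
  fixes B :: "'a::field ^ 'n ^ 'n"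
  assumes "det B = 0"
  obtains x where "\<exists>i. x i \<noteq> 0" "\<And>k. (\<Sum>i\<in>UNIV. x i * B $ i $ k) = 0"
proof -
  have "\<nexists>C. B ** C = mat 1"
    using assms by (metis invertible_det_nz invertible_right_inverse)
  then obtain x where "(\<Sum>i\<in>UNIV. x i *s row i B) = 0" "\<exists>i. x i \<noteq> 0"
    unfolding matrix_right_invertible_independent_rows by blast
  then show thesis
    by (intro that[of x]) (auto simp: vec_eq_iff row_def)
qed

text \<open>The contradiction is a parameter point with a zero at which the genericity polynomial
  \<open>f\<close> does not vanish. It must also make a block determinant nonconstant and a maximal
  minor nonzero; it is found on a line from a nonroot of \<open>f\<close> to a point where these two
  conditions hold.\<close>

lemma property_P_necessary:
  fixes M :: "real poly ^ 'v ^ 'p"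
  assumes gen: "generically M (\<lambda>M'. zeros M' = {})"
  shows "property_P (edges M) (weight M)"
proof (rule ccontr)
  let ?E' = "nonredundant_edges (edges M)"
  assume "\<not> property_P (edges M) (weight M)"
  then obtain r c e where "card r = card c"
    and match: "\<And>m. R_saturating (edges M) m \<Longrightarrow> m `` r = c"
    and e: "e \<in> ?E'" "fst e \<in> r" "weight M e \<noteq> 0"
    unfolding property_P_def matches_def by blast
  obtain m where m: "R_saturating (edges M) m" "e \<in> m"
    using e(1) by (rule nonredundant_edge_in_matching)
  obtain \<sigma> where \<sigma>: "inj \<sigma>" "m = range (\<lambda>i. (i, \<sigma> i))"
    using m(1) by (rule R_saturating_graph)
  have \<sigma>_E': "(i, \<sigma> i) \<in> ?E'" for i
    using R_saturating_nonredundant[OF m(1)] \<sigma>(2) by blast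
  then have \<sigma>_E: "(i, \<sigma> i) \<in> edges M" for i
    using nonredundant_edges_subset[of "edges M"] by blast
  have c: "c = \<sigma> ` r"
    using match[OF m(1)] by (auto simp: \<sigma>(2))
  \<comment> \<open>Some matching contains the edge and sends \<open>r\<close> onto
    \<open>c\<close>; hence the rows \<open>r\<close> of the nonredundant part vanish outside
    \<open>c\<close>.\<close>
  have into_c: "j \<in> c" if ij: "(i, j) \<in> ?E'" "i \<in> r" for i j
  proof -
    obtain m' where m': "R_saturating (edges M) m'" "(i, j) \<in> m'"
      using ij(1) by (rule nonredundant_edge_in_matching)
    then show ?thesis
      using match[OF m'(1)] ij(2) by blast
  qed
  obtain f where f: "f \<noteq> 0" "mpoly_vars f \<subseteq> params M"
    "{a \<in> params M \<rightarrow>\<^sub>E UNIV. \<not> zeros (family_matrix M a) = {}} \<subseteq> {a. mpoly_eval f a = 0}"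
    using gen unfolding generically_def by blast
  have f_fun: "poly_fun (params M) (mpoly_eval f)"
    unfolding poly_fun_def using f(2) by blast
  obtain a1 where a1: "mpoly_eval f a1 \<noteq> 0"
    using mpoly_nonzero_has_nonroot[OF f(1)] by blast
  define w where "w i = weight M (i, \<sigma> i)" for i
  \<comment> \<open>At \<open>a0\<close> the only entries are the monomials of top degree on the matching, so the determinants
    below are monomials; the generic case follows by moving along a line through \<open>a0\<close>.\<close>
  define a0 where "a0 = (\<lambda>(i, j, k). if j = \<sigma> i \<and> k = w i then 1 else (0 :: real))"
  \<comment> \<open>The block on rows \<open>r\<close> and columns \<open>c\<close>, padded by
    identity rows. For \<open>k\<close> outside \<open>r\<close>, \<open>\<sigma> k\<close> is not
    in \<open>c\<close>, so the padding keeps the determinant.\<close>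
  define B where "B a = (\<chi> i k. if i \<in> r then restrict_entries ?E' (family_matrix M a) $ i $ \<sigma> k
      else if i = k then 1 else (0 :: real poly))" for a
  define value_at where "value_at s A = map_matrix (\<lambda>q. poly q s) A" for s :: real and A :: "real poly ^ 'p ^ 'p"
  have det_value_at: "det (value_at s A) = poly (det A) s" for s A
    unfolding value_at_def by (rule det_map_matrix) auto
  have family_a0: "family_matrix M a0 $ i $ \<sigma> k = (if k = i then monom 1 (w i) else 0)" for i k
  proof (cases "k = i")
    case True
    have "(\<Sum>q\<le>w i. monom (a0 (i, \<sigma> i, q)) q) = (\<Sum>q\<le>w i. if q = w i then monom 1 q else 0)"
      by (intro sum.cong) (auto simp: a0_def)
    then show ?thesis
      using True \<sigma>_E by (simp add: family_matrix_def flip: w_def)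
  next
    case False
    then have "\<sigma> k \<noteq> \<sigma> i"
      using \<sigma>(1) by (auto dest: injD)
    then show ?thesis
      using False by (simp add: family_matrix_def a0_def)
  qed
  have det_B_a0: "det (B a0) = (\<Prod>i\<in>UNIV. if i \<in> r then monom 1 (w i) else 1)"
    by (subst det_diagonal) (auto simp: B_def restrict_entries_nth family_a0 \<sigma>_E' intro!: prod.cong)
  have det_sel_a0: "det (select_cols \<sigma> (family_matrix M a0)) = (\<Prod>i\<in>UNIV. monom 1 (w i))"
    by (subst det_diagonal) (auto simp: select_cols_def family_a0)
  \<comment> \<open>\<open>det (B a0)\<close> is a power of \<open>s\<close> with positive exponent,
    owing to the edge \<open>e\<close>. Comparing the values at 1 and 0 makes nonconstancy a
    polynomial condition on the parameters.\<close>
  have "poly (det (B a0)) 1 = 1"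
    unfolding det_B_a0 by (auto simp: poly_prod poly_monom intro!: prod.neutral)
  moreover have "poly (det (B a0)) 0 = 0"
  proof -
    obtain i where "e = (i, \<sigma> i)"
      using m(2) \<sigma>(2) by blast
    then have "i \<in> r" "w i \<noteq> 0"
      using e by (auto simp: w_def)
    then show ?thesis
      unfolding det_B_a0 poly_prod by (intro prod_zero bexI[of _ i]) (auto simp: poly_monom)
  qed
  moreover have "poly (det (select_cols \<sigma> (family_matrix M a0))) 1 = 1"
    unfolding det_sel_a0 by (simp add: poly_prod poly_monom)
  ultimately have at_a0: "(poly (det (B a0)) 1 - poly (det (B a0)) 0) *
      poly (det (select_cols \<sigma> (family_matrix M a0))) 1 \<noteq> 0"
    by simp
  let ?l = "line a1 a0"
  have entry: "univariate_poly (\<lambda>t. poly (family_matrix M (?l t) $ i $ j) s)" for i j s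
  proof (cases "(i, j) \<in> edges M")
    case True
    then have "(\<lambda>t. poly (family_matrix M (?l t) $ i $ j) s) =
        (\<lambda>t. \<Sum>k\<le>weight M (i, j). ?l t (i, j, k) * s ^ k)"
      by (simp add: family_matrix_def poly_sum poly_monom)
    then show ?thesis
      by (simp only:) (intro univariate_poly_intros univariate_poly_line)
  next
    case False
    then show ?thesis
      by (simp add: family_matrix_def univariate_poly_const)
  qed
  have univariate_poly_B: "univariate_poly (\<lambda>t. poly (det (B (?l t))) s)" for s
    unfolding det_value_at[symmetric]
  proof (rule univariate_poly_det)
    fix i j
    show "univariate_poly (\<lambda>t. value_at s (B (?l t)) $ i $ j)"
      by (cases "i \<in> r"; cases "(i, \<sigma> j) \<in> ?E'")
        (auto simp: value_at_def B_def restrict_entries_nth entry univariate_poly_const)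
  qed
  have univariate_poly_sel: "univariate_poly (\<lambda>t. poly (det (select_cols \<sigma> (family_matrix M (?l t)))) s)" for s
    unfolding det_value_at[symmetric]
    by (rule univariate_poly_det) (simp add: value_at_def select_cols_def entry)
  \<comment> \<open>Parameter 0 is \<open>a1\<close>, where \<open>f\<close> is nonzero; parameter 1
    is \<open>a0\<close>, where the other factor is.\<close>
  have "\<exists>u. mpoly_eval f (?l u) * ((poly (det (B (?l u))) 1 - poly (det (B (?l u))) 0) *
      poly (det (select_cols \<sigma> (family_matrix M (?l u)))) 1) \<noteq> 0"
    using a1 at_a0
    by (intro univariate_poly_mult_nonzero[where s = 0 and t = 1] univariate_poly_poly_fun_line[OF f_fun]
        univariate_poly_mult univariate_poly_diff univariate_poly_B univariate_poly_sel) auto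
  then obtain u where u: "mpoly_eval f (?l u) \<noteq> 0" "poly (det (B (?l u))) 1 \<noteq> poly (det (B (?l u))) 0"
    "det (select_cols \<sigma> (family_matrix M (?l u))) \<noteq> 0"
    by fastforce
  define a where "a = ?l u"
  have "\<exists>z. cpoly (det (B a)) z = 0"
    unfolding cpoly_def
  proof (rule fundamental_theorem_of_algebra, rule notI)
    assume "constant (poly (map_poly complex_of_real (det (B a))))"
    then have "cpoly (det (B a)) (complex_of_real 1) = cpoly (det (B a)) (complex_of_real 0)"
      unfolding cpoly_def constant_def by blast
    then show False
      using u(2) unfolding cpoly_of_real a_def by simp
  qed
  then obtain z where "cpoly (det (B a)) z = 0" ..
  then have "det (map_matrix (\<lambda>q. cpoly q z) (B a)) = 0"
    by (subst det_map_matrix) (auto simp: cpoly_0 cpoly_1 cpoly_add cpoly_mult)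
  then obtain x where x: "\<exists>i. x i \<noteq> 0" "\<And>k. (\<Sum>i\<in>UNIV. x i * map_matrix (\<lambda>q. cpoly q z) (B a) $ i $ k) = 0"
    by (rule det_0_left_kernel) (rule that)
  let ?A = "eval_matrix (family_matrix M a) z"
  have B_nth: "map_matrix (\<lambda>q. cpoly q z) (B a) $ i $ k =
      (if i \<in> r then restrict_entries ?E' ?A $ i $ \<sigma> k else if i = k then 1 else 0)" for i k
    by (simp add: B_def restrict_entries_nth eval_matrix_nth cpoly_0 cpoly_1)
  have outside: "restrict_entries ?E' ?A $ i $ j = 0" if "i \<in> r" "j \<notin> c" for i j
    using into_c[of i j] that by (auto simp: restrict_entries_nth)
  \<comment> \<open>Outside \<open>r\<close>, column \<open>k\<close> of the padded block has the
    single entry 1.\<close>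
  have x_r: "x k = 0" if "k \<notin> r" for k
  proof -
    have "\<sigma> k \<notin> c"
      using that \<sigma>(1) by (auto simp: c dest: injD)
    then have "(\<Sum>i\<in>UNIV. x i * map_matrix (\<lambda>q. cpoly q z) (B a) $ i $ k) = (\<Sum>i\<in>UNIV. if i = k then x i else 0)"
      using that outside by (intro sum.cong) (auto simp: B_nth simp del: nth_map_matrix)
    then show ?thesis
      using x(2)[of k] by simp
  qed
  \<comment> \<open>Columns in \<open>c\<close> are columns of the padded block; the others vanish
    on \<open>r\<close>, where \<open>x\<close> lives.\<close>
  have "(\<Sum>i\<in>UNIV. x i * restrict_entries ?E' ?A $ i $ j) = 0" for j
  proof (cases "j \<in> c")
    case True
    then obtain k where k: "k \<in> r" "j = \<sigma> k"
      by (auto simp: c)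
    have "(\<Sum>i\<in>UNIV. x i * restrict_entries ?E' ?A $ i $ j) = (\<Sum>i\<in>UNIV. x i * map_matrix (\<lambda>q. cpoly q z) (B a) $ i $ k)"
      using k x_r by (intro sum.cong refl) (simp add: B_nth del: nth_map_matrix)
    then show ?thesis
      using x(2)[of k] by simp
  next
    case False
    then have "x i * restrict_entries ?E' ?A $ i $ j = 0" for i
      using x_r[of i] outside[of i j] by (cases "i \<in> r") auto
    then show ?thesis
      by (intro sum.neutral) blast
  qed
  then have "rank (restrict_entries ?E' ?A) \<noteq> CARD('p)"
    using x(1) unfolding rank_full_iff_independent_rows by blast
  then have "rank ?A \<noteq> CARD('p)"
    by (subst (asm) rank_restrict_entries_full) (auto simp: eval_family_matrix_nth)
  then have "rank ?A < CARD('p)"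
    using rank_le_rows[of ?A] by simp
  \<comment> \<open>A nonzero maximal minor makes the polynomial rank full, so the defect at
    \<open>z\<close> is a genuine drop.\<close>
  moreover have "poly_rank (family_matrix M a) = CARD('p)"
  proof -
    have "select_cols \<sigma> (map_matrix to_fract (family_matrix M a)) =
        map_matrix to_fract (select_cols \<sigma> (family_matrix M a))"
      by (simp add: vec_eq_iff select_cols_def)
    moreover have "det (map_matrix to_fract (select_cols \<sigma> (family_matrix M a))) =
        to_fract (det (select_cols \<sigma> (family_matrix M a)))"
      by (rule det_map_matrix) auto
    ultimately have "det (select_cols \<sigma> (map_matrix to_fract (family_matrix M a))) \<noteq> 0"
      using u(3) by (simp add: a_def)
    then show ?thesis
      unfolding poly_rank_def rank_full_iff_nonzero_minor by blast
  qed
  ultimately have "z \<in> zeros (family_matrix M a)"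
    by (simp add: zeros_def)
  \<comment> \<open>\<open>f\<close> and the family see only coordinates in \<open>params M\<close>,
    so the point can be moved into the extensional parameter space.\<close>
  moreover have "family_matrix M (restrict a (params M)) = family_matrix M a"
    by (rule family_matrix_cong) simp
  moreover have "mpoly_eval f (restrict a (params M)) = mpoly_eval f a"
    by (rule poly_fun_cong[OF f_fun]) simp
  ultimately have "restrict a (params M) \<in> {a \<in> params M \<rightarrow>\<^sub>E UNIV. \<not> zeros (family_matrix M a) = {}}"
    "mpoly_eval f (restrict a (params M)) \<noteq> 0"
    using u(1) by (auto simp: a_def)
  then show False
    using f(3) by blast
qed

theorem theorem4:
  fixes M :: "real poly ^ 'v ^ 'p"
  assumes "CARD('p) \<le> CARD('v)"
    and "\<exists>m. R_saturating (edges M) m"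
  shows "generically M (\<lambda>M'. zeros M' = {}) \<longleftrightarrow> property_P (edges M) (weight M)"
  using generically_no_zeros[OF assms(2)] property_P_necessary by blast

end
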